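(* Suppose that $\mathfrak C\in L(\mathcal H)$ is a normal and compact operator with eigenvectors $(E_j)_{j\in\mathbb N}$ forming an orthonormal basis of $\mathcal H$ and corresponding eigenvalues $(\Lambda_j)_{j\in\mathbb N}$. Let $\mathcal U_n=\mathrm{span}\{E_j: j\in J_n\}$, where $(J_n)_{n\in\mathbb N}$ is a nested sequence of finite subsets of $\mathbb N$, i.e. $J_n\subset J_{n+1}$ for all $n\ge1$, and let $\mathfrak C^n=\Pi_n\mathfrak C\Pi_n$, where $\Pi_n\in L(\mathcal H)$ is the orthogonal projection onto $\mathcal U_n$. Let $\mathcal V$ and $\mathcal V^n$ be the variance processes given by $$d\mathcal V(t)=\mathfrak C\mathcal V(t)\,dt+d\mathcal L(t),\ \ \mathcal V(0)=\mathcal V_0,\qquad d\mathcal V^n(t)=\mathfrak C^n\mathcal V^n(t)\,dt+d\mathcal L^n(t),\ \ \mathcal V^n(0)=\mathcal V^n_0,$$ where $\mathcal V_0^n=\mathcal V_0$ and $\mathcal L^n=\mathcal L$ for all $n\ge1$, and $\mathcal L(t)=\sum_{i=1}^{N(t)}\mathcal X_i$ is a square-integrable $\mathcal H$-valued compound Poisson process. Then for every $T>0$, $$\mathbb E\Big[\sup_{0\le t\le T}\|\mathcal V(t)-\mathcal V^n(t)\|_{\mathcal H}^2\Big]\le C(T)\sup_{m\in J_n^c}\Lambda_m^2,$$ where $$C(T)=4T^2e^{2T\|\mathfrak C\|_{\mathrm{op}}}\Big(\mathbb E[\|\mathcal V_0\|_{\mathcal H}^2]+\lambda T\,\mathbb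 E[\|\mathcal X_1\|_{\mathcal H}^2]+\lambda^2T^2\big(\mathbb E[\|\mathcal X_1\|_{\mathcal H}]\big)^2\Big),$$ and the right-hand side of this inequality converges to zero as $n\to\infty$.
   Context: $H$ is a separable real Hilbert space and $\mathcal H=L_{HS}(H)$ is the Hilbert space of Hilbert-Schmidt operators on $H$ with norm $\|\cdot\|_{\mathcal H}$. $L(\mathcal H)$ is the Banach algebra of bounded linear operators on $\mathcal H$, with operator norm $\|\cdot\|_{\mathrm{op}}$. An operator is normal if it commutes with its adjoint. $J_n^c=\mathbb N\setminus J_n$. $N$ is a Poisson process with intensity $\lambda>0$ (right-continuous with left limits), and $(\mathcal X_i)_{i\ge1}$ are i.i.d. $\mathcal H$-valued random variables independent of $N$. $\mathcal V_0$ is an $\mathcal H$-valued initial value. The solution of $d\mathcal V(t)=\mathfrak C\mathcal V(t)dt+d\mathcal L(t)$, $\mathcal V(0)=\mathcal V_0$, is $\mathcal V(t)=e^{\mathfrak Ct}\mathcal V_0+\int_0^te^{\mathfrak C(t-s)}d\mathcal L(s)=e^{\mathfrak Ct}\mathcal V_0+\sum_{i:T_i\le t}e^{\mathfrak C(t-T_i)}\mathcal X_i$, with $T_i$ the jump times of $N$; similarly for $\mathcal V^n$ with $\mathfrak C^n$ in place of $\mathfrak C$.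
   Formalization: Convergence of the right-hand side to zero is claimed only when E[‖V_0‖²] is finite and every j with Λ_j ≠ 0 lies in some J_n; without these it fails, e.g. for J_n = {2,4,…,2n} with Λ_1 ≠ 0 and V_0 ≠ 0, or because C(T) is infinite. *)

theory Defs
  imports "HOL-Probability.Probability"
begin

definition is_onb :: "'a::real_inner set \<Rightarrow> bool" where
  "is_onb B \<longleftrightarrow> (\<forall>x\<in>B. norm x = 1) \<and> pairwise orthogonal B \<and> closure (span B) = UNIV"

definition is_onb_seq :: "(nat \<Rightarrow> 'a::real_inner) \<Rightarrow> bool" where
  "is_onb_seq E \<longleftrightarrow> inj E \<and> is_onb (range E)"

lemma orthonormal_insert:
  fixes S :: "'a::real_inner set" and d :: 'a
  assumes "finite S" "\<forall>x\<in>S. norm x = 1" "pairwise orthogonal S"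
  obtains T where "finite T" "S \<subseteq> T" "\<forall>x\<in>T. norm x = 1" "pairwise orthogonal T" "d \<in> span T"
proof -
  define r where "r = d - (\<Sum>e\<in>S. (d \<bullet> e) *\<^sub>R e)"
  have orth: "r \<bullet> x = 0" if "x \<in> S" for x
  proof -
    have "(\<Sum>e\<in>S. (d \<bullet> e) * (e \<bullet> x)) = (\<Sum>e\<in>S. if e = x then d \<bullet> x else 0)"
      using assms that by (intro sum.cong refl)
        (auto simp: pairwise_def orthogonal_def norm_eq_1)
    also have "\<dots> = d \<bullet> x" using assms(1) that by simp
    finally show ?thesis by (simp add: r_def inner_diff_left inner_sum_left)
  qed
  have d: "d = r + (\<Sum>e\<in>S. (d \<bullet> e) *\<^sub>R e)" by (simp add: r_def)
  have s: "(\<Sum>e\<in>S. (d \<bullet> e) *\<^sub>R e) \<in> span S"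
    by (intro span_sum span_scale span_base)
  show ?thesis
  proof (cases "r = 0")
    case True
    with d s have "d \<in> span S" by simp
    with assms that[of S] show ?thesis by auto
  next
    case False
    define u where "u = (1 / norm r) *\<^sub>R r"
    have u: "norm u = 1" using False by (simp add: u_def)
    have uo: "u \<bullet> x = 0" if "x \<in> S" for x using orth[OF that] by (simp add: u_def)
    have r: "r = norm r *\<^sub>R u" using False by (simp add: u_def)
    have "d \<in> span (insert u S)"
    proof (subst d, rule span_add)
      show "r \<in> span (insert u S)" by (subst r) (intro span_scale span_base insertI1)
      show "(\<Sum>e\<in>S. (d \<bullet> e) *\<^sub>R e) \<in> span (insert u S)"
        using s span_mono[OF subset_insertI] by blast
    qed
    moreover have "pairwise orthogonal (insert u S)"
      using assms(3) uo by (simp add: pairwise_insert orthogonal_def) (metis inner_commute)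
    ultimately show ?thesis using assms u that[of "insert u S"] by auto
  qed
qed

lemma ex_onb: "\<exists>B::'a::{real_inner,second_countable_topology} set. is_onb B"
proof -
  obtain D :: "'a set" where D: "countable D" "\<And>X. open X \<Longrightarrow> X \<noteq> {} \<Longrightarrow> \<exists>d\<in>D. d \<in> X"
    using countable_dense_setE by blast
  have "D \<noteq> {}" using D(2)[of UNIV] by auto
  define d where "d = from_nat_into D"
  have dD: "range d = D" unfolding d_def by (rule range_from_nat_into[OF \<open>D \<noteq> {}\<close> D(1)])
  define ok where "ok S \<longleftrightarrow> finite S \<and> (\<forall>x\<in>S. norm x = 1) \<and> pairwise orthogonal S" for S :: "'a set"
  have step: "\<exists>T. ok T \<and> S \<subseteq> T \<and> d n \<in> span T" if "ok S" for S n
    using that orthonormal_insert[of S "d n"] unfolding ok_def by metis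
  have "\<exists>f. \<forall>n. ok (f n) \<and> f n \<subseteq> f (Suc n) \<and> d n \<in> span (f (Suc n))"
  proof -
    have "\<exists>f. \<forall>n. ok (f n) \<and> (f n \<subseteq> f (Suc n) \<and> d n \<in> span (f (Suc n)))"
      by (rule dependent_nat_choice[where P="\<lambda>n S. ok S"
            and Q="\<lambda>n S T. S \<subseteq> T \<and> d n \<in> span T"])
        (use step in \<open>auto simp: ok_def intro!: exI[of _ "{}"]\<close>)
    then show ?thesis by blast
  qed
  then obtain f where f: "\<And>n. ok (f n)" "\<And>n. f n \<subseteq> f (Suc n)" "\<And>n. d n \<in> span (f (Suc n))"
    by blast
  have mono: "m \<le> n \<Longrightarrow> f m \<subseteq> f n" for m n using f(2) by (rule lift_Suc_mono_le)
  define B where "B = (\<Union>n. f n)"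
  have "\<forall>x\<in>B. norm x = 1" using f(1) by (auto simp: B_def ok_def)
  moreover have "pairwise orthogonal B"
  proof (rule pairwiseI)
    fix x y assume "x \<in> B" "y \<in> B" "x \<noteq> y"
    then obtain m n where "x \<in> f m" "y \<in> f n" by (auto simp: B_def)
    then have "x \<in> f (max m n)" "y \<in> f (max m n)"
      using mono[of m "max m n"] mono[of n "max m n"] by auto
    then show "orthogonal x y" using f(1) \<open>x \<noteq> y\<close> by (auto simp: ok_def pairwise_def)
  qed
  moreover have "closure (span B) = UNIV"
  proof -
    have "D \<subseteq> span B"
    proof
      fix x assume "x \<in> D"
      then obtain n where "x = d n" using dD by blast
      then show "x \<in> span B" using f(3)[of n] span_mono[of "f (Suc n)" B] by (auto simp: B_def)
    qed
    have "x \<in> closure (span B)" for x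
      unfolding closure_iff_nhds_not_empty
    proof safe
      fix A V assume "x \<in> V" "open V" "V \<subseteq> A" "span B \<inter> A = {}"
      moreover obtain y where "y \<in> D" "y \<in> V" using D(2)[OF \<open>open V\<close>] \<open>x \<in> V\<close> by auto
      ultimately show False using \<open>D \<subseteq> span B\<close> by auto
    qed
    then show ?thesis by auto
  qed
  ultimately show ?thesis by (auto simp: is_onb_def)
qed

definition hs_basis :: "'a::{real_inner,second_countable_topology} set" where
  "hs_basis = (SOME B. is_onb B)"

lemma hs_basis: "is_onb hs_basis"
  unfolding hs_basis_def using ex_onb by (rule someI_ex)

lemma closure_span_hs_basis: "closure (span hs_basis) = UNIV"
  using hs_basis unfolding is_onb_def by (elim conjE)

lemma inner_hs_basis:
  fixes e e' :: "'a::{real_inner,second_countable_topology}"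
  shows "e \<in> hs_basis \<Longrightarrow> e' \<in> hs_basis \<Longrightarrow> e \<bullet> e' = (if e = e' then 1 else 0)"
  using hs_basis[where 'a='a] unfolding is_onb_def pairwise_def orthogonal_def norm_eq_1
  by (cases "e = e'") auto


text \<open>
  By Parseval's identity neither the summability condition below nor the resulting inner
  product depends on the orthonormal basis, so an arbitrary basis is fixed.
\<close>

typedef (overloaded) 'a hilbert_schmidt =
  "{A :: 'a::{real_inner,banach,second_countable_topology} \<Rightarrow>\<^sub>L 'a.
      (\<lambda>e. (norm (A e))\<^sup>2) summable_on hs_basis}"
  morphisms hs_op Abs_hs
  by (rule exI[of _ 0]) (simp add: zero_blinfun.rep_eq)

setup_lifting type_definition_hilbert_schmidt

lemma hs_summable: "(\<lambda>e. (norm (hs_op A e))\<^sup>2) summable_on hs_basis"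
  using hs_op[of A] by simp

lemma hs_summable_mult:
  "(\<lambda>e. norm (hs_op A e) * norm (hs_op B e)) summable_on hs_basis"
proof (rule summable_on_comparison_test)
  show "(\<lambda>e. (norm (hs_op A e))\<^sup>2 + (norm (hs_op B e))\<^sup>2) summable_on hs_basis"
    by (intro summable_on_add hs_summable)
  show "norm (hs_op A e) * norm (hs_op B e) \<le> (norm (hs_op A e))\<^sup>2 + (norm (hs_op B e))\<^sup>2" for e
    using sum_squares_bound[of "norm (hs_op A e)" "norm (hs_op B e)"]
      mult_nonneg_nonneg[of "norm (hs_op A e)" "norm (hs_op B e)"]
    unfolding mult.assoc by (smt (verit) norm_ge_zero)
qed simp

lemma hs_summable_inner: "(\<lambda>e. hs_op A e \<bullet> hs_op B e) summable_on hs_basis"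
proof (rule abs_summable_summable, rule summable_on_comparison_test[OF hs_summable_mult[of A B]])
  show "norm (hs_op A e \<bullet> hs_op B e) \<le> norm (hs_op A e) * norm (hs_op B e)" for e
    by (simp add: Cauchy_Schwarz_ineq2)
qed simp

instantiation hilbert_schmidt ::
  ("{real_inner,banach,second_countable_topology}") real_inner
begin

lift_definition zero_hilbert_schmidt :: "'a hilbert_schmidt" is 0
  by (simp add: zero_blinfun.rep_eq)

lift_definition plus_hilbert_schmidt :: "'a hilbert_schmidt \<Rightarrow> 'a hilbert_schmidt \<Rightarrow> 'a hilbert_schmidt"
  is "(+)"
proof -
  fix A B :: "'a \<Rightarrow>\<^sub>L 'a"
  assume *: "(\<lambda>e. (norm (A e))\<^sup>2) summable_on hs_basis" "(\<lambda>e. (norm (B e))\<^sup>2) summable_on hs_basis"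
  show "(\<lambda>e. (norm ((A + B) e))\<^sup>2) summable_on hs_basis"
  proof (rule summable_on_comparison_test)
    show "(\<lambda>e. 2 * (norm (A e))\<^sup>2 + 2 * (norm (B e))\<^sup>2) summable_on hs_basis"
      by (intro summable_on_add summable_on_cmult_right *)
    show "(norm ((A + B) e))\<^sup>2 \<le> 2 * (norm (A e))\<^sup>2 + 2 * (norm (B e))\<^sup>2" for e
    proof -
      have "(norm ((A + B) e))\<^sup>2 \<le> (norm (A e) + norm (B e))\<^sup>2"
        by (intro power_mono) (simp_all add: plus_blinfun.rep_eq norm_triangle_ineq)
      also have "\<dots> \<le> 2 * (norm (A e))\<^sup>2 + 2 * (norm (B e))\<^sup>2"
        using sum_squares_bound[of "norm (A e)" "norm (B e)"] by (simp add: power2_sum)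
      finally show ?thesis .
    qed
  qed simp
qed

lift_definition scaleR_hilbert_schmidt :: "real \<Rightarrow> 'a hilbert_schmidt \<Rightarrow> 'a hilbert_schmidt"
  is "(*\<^sub>R)"
  by (simp add: scaleR_blinfun.rep_eq power_mult_distrib summable_on_cmult_right)

definition uminus_hilbert_schmidt :: "'a hilbert_schmidt \<Rightarrow> 'a hilbert_schmidt" where
  "- A = (-1) *\<^sub>R A" for A :: "'a hilbert_schmidt"

definition minus_hilbert_schmidt :: "'a hilbert_schmidt \<Rightarrow> 'a hilbert_schmidt \<Rightarrow> 'a hilbert_schmidt" where
  "A - B = A + (- B)" for A B :: "'a hilbert_schmidt"

definition inner_hilbert_schmidt :: "'a hilbert_schmidt \<Rightarrow> 'a hilbert_schmidt \<Rightarrow> real" where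
  "A \<bullet> B = (\<Sum>\<^sub>\<infinity>e\<in>hs_basis. hs_op A e \<bullet> hs_op B e)" for A B :: "'a hilbert_schmidt"

definition norm_hilbert_schmidt :: "'a hilbert_schmidt \<Rightarrow> real" where
  "norm A = sqrt (A \<bullet> A)" for A :: "'a hilbert_schmidt"

definition dist_hilbert_schmidt :: "'a hilbert_schmidt \<Rightarrow> 'a hilbert_schmidt \<Rightarrow> real" where
  "dist A B = norm (A - B)" for A B :: "'a hilbert_schmidt"

definition sgn_hilbert_schmidt :: "'a hilbert_schmidt \<Rightarrow> 'a hilbert_schmidt" where
  "sgn A = inverse (norm A) *\<^sub>R A" for A :: "'a hilbert_schmidt"

definition [code del]:
  "(uniformity :: ('a hilbert_schmidt \<times> 'a hilbert_schmidt) filter) =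
     (INF e\<in>{0 <..}. principal {(x, y). dist x y < e})"

definition open_hilbert_schmidt :: "'a hilbert_schmidt set \<Rightarrow> bool" where
  [code del]: "open_hilbert_schmidt S \<longleftrightarrow>
     (\<forall>x\<in>S. \<forall>\<^sub>F (x', y) in uniformity. x' = x \<longrightarrow> y \<in> S)"

instance
proof
  fix A B C :: "'a hilbert_schmidt" and r s :: real
  show "A + B + C = A + (B + C)" by transfer simp
  show "A + B = B + A" by transfer simp
  show "0 + A = A" by transfer simp
  show "- A + A = 0" unfolding uminus_hilbert_schmidt_def by transfer simp
  show "A - B = A + - B" by (rule minus_hilbert_schmidt_def)
  show "r *\<^sub>R (A + B) = r *\<^sub>R A + r *\<^sub>R B" by transfer (simp add: scaleR_add_right)
  show "(r + s) *\<^sub>R A = r *\<^sub>R A + s *\<^sub>R A" by transfer (simp add: scaleR_add_left)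
  show "r *\<^sub>R s *\<^sub>R A = (r * s) *\<^sub>R A" by transfer simp
  show "1 *\<^sub>R A = A" by transfer simp
  show "dist A B = norm (A - B)" by (rule dist_hilbert_schmidt_def)
  show "sgn A = inverse (norm A) *\<^sub>R A" by (rule sgn_hilbert_schmidt_def)
  show "(uniformity :: ('a hilbert_schmidt \<times> 'a hilbert_schmidt) filter) =
     (INF e\<in>{0 <..}. principal {(x, y). dist x y < e})"
    by (rule uniformity_hilbert_schmidt_def)
  show "open U \<longleftrightarrow> (\<forall>x\<in>U. \<forall>\<^sub>F (x', y) in uniformity. x' = x \<longrightarrow> y \<in> U)"
    for U :: "'a hilbert_schmidt set" by (rule open_hilbert_schmidt_def)
  show "A \<bullet> B = B \<bullet> A" by (simp add: inner_hilbert_schmidt_def inner_commute)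
  show "(A + B) \<bullet> C = A \<bullet> C + B \<bullet> C"
    by (simp add: inner_hilbert_schmidt_def plus_hilbert_schmidt.rep_eq plus_blinfun.rep_eq
        inner_add_left infsum_add hs_summable_inner)
  show "(r *\<^sub>R A) \<bullet> B = r * (A \<bullet> B)"
    by (simp add: inner_hilbert_schmidt_def scaleR_hilbert_schmidt.rep_eq scaleR_blinfun.rep_eq
        infsum_cmult_right')
  show "0 \<le> A \<bullet> A" by (simp add: inner_hilbert_schmidt_def infsum_nonneg)
  show "norm A = sqrt (A \<bullet> A)" by (rule norm_hilbert_schmidt_def)
  show "A \<bullet> A = 0 \<longleftrightarrow> A = 0"
  proof
    assume "A = 0"
    then show "A \<bullet> A = 0"
      by (simp add: inner_hilbert_schmidt_def zero_hilbert_schmidt.rep_eq zero_blinfun.rep_eq)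
  next
    assume "A \<bullet> A = 0"
    then have z: "hs_op A e = 0" if "e \<in> hs_basis" for e
      using nonneg_infsum_le_0D[of "\<lambda>e. hs_op A e \<bullet> hs_op A e" hs_basis e]
      by (simp add: inner_hilbert_schmidt_def hs_summable_inner that)
    have "span hs_basis \<subseteq> {x. hs_op A x = 0}"
      by (rule span_minimal) (auto simp: z subspace_def blinfun.bilinear_simps)
    moreover have "closed {x. hs_op A x = 0}"
      by (intro closed_Collect_eq continuous_intros)
    ultimately have "closure (span hs_basis) \<subseteq> {x. hs_op A x = 0}"
      by (rule closure_minimal)
    then have "hs_op A = 0"
      unfolding closure_span_hs_basis by (intro blinfun_eqI) auto
    then show "A = 0" by transfer simp
  qed
qed

end

lemma hs_norm_power2: "(norm A)\<^sup>2 = (\<Sum>\<^sub>\<infinity>e\<in>hs_basis. (norm (hs_op A e))\<^sup>2)"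
  for A :: "'a::{real_inner,banach,second_countable_topology} hilbert_schmidt"
  by (simp add: power2_norm_eq_inner inner_hilbert_schmidt_def)

lemma hs_op_diff: "hs_op (A - B) = hs_op A - hs_op B"
  unfolding minus_hilbert_schmidt_def uminus_hilbert_schmidt_def plus_hilbert_schmidt.rep_eq
    scaleR_hilbert_schmidt.rep_eq
  by simp

lemma norm_hs_op_le: "norm (hs_op A) \<le> norm A"
proof (rule norm_blinfun_bound)
  fix x
  have "span hs_basis \<subseteq> {x. norm (hs_op A x) \<le> norm A * norm x}"
  proof
    fix x :: 'a assume "x \<in> span hs_basis"
    then obtain F c where F: "finite F" "F \<subseteq> hs_basis" and x: "x = (\<Sum>e\<in>F. c e *\<^sub>R e)"
      unfolding span_explicit by blast
    have ip: "e \<bullet> e' = (if e = e' then 1 else 0)" if "e \<in> F" "e' \<in> F" for e e'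
      using F that by (intro inner_hs_basis) auto
    have ex: "e \<bullet> x = c e" if "e \<in> F" for e
    proof -
      have "e \<bullet> x = (\<Sum>e'\<in>F. c e' * (e \<bullet> e'))" by (simp add: x inner_sum_right)
      also have "\<dots> = (\<Sum>e'\<in>F. if e = e' then c e else 0)"
        by (intro sum.cong refl) (simp add: ip that)
      also have "\<dots> = c e" using F(1) that by simp
      finally show ?thesis .
    qed
    have "x \<bullet> x = (\<Sum>e\<in>F. c e * (e \<bullet> x))"
      by (subst (1) x) (simp add: inner_sum_left)
    also have "\<dots> = (\<Sum>e\<in>F. (c e)\<^sup>2)"
      by (intro sum.cong refl) (simp add: ex power2_eq_square)
    finally have nx: "norm x = L2_set c F"
      by (simp add: norm_eq_sqrt_inner L2_set_def)
    have "norm (hs_op A x) = norm (\<Sum>e\<in>F. c e *\<^sub>R hs_op A e)"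
      by (simp add: x blinfun.bilinear_simps blinfun.sum_right)
    also have "\<dots> \<le> (\<Sum>e\<in>F. \<bar>c e\<bar> * \<bar>norm (hs_op A e)\<bar>)"
      by (rule sum_norm_le) simp
    also have "\<dots> \<le> L2_set c F * L2_set (\<lambda>e. norm (hs_op A e)) F"
      by (rule L2_set_mult_ineq)
    finally have *: "norm (hs_op A x) \<le> L2_set c F * L2_set (\<lambda>e. norm (hs_op A e)) F" .
    have "L2_set (\<lambda>e. norm (hs_op A e)) F \<le> norm A"
    proof (rule power2_le_imp_le)
      show "(L2_set (\<lambda>e. norm (hs_op A e)) F)\<^sup>2 \<le> (norm A)\<^sup>2"
        unfolding hs_norm_power2 L2_set_def
        using finite_sum_le_infsum[OF hs_summable F] by (simp add: sum_nonneg)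
    qed simp
    then have "norm (hs_op A x) \<le> L2_set c F * norm A"
      by (rule order_trans[OF * mult_left_mono]) simp
    then show "x \<in> {x. norm (hs_op A x) \<le> norm A * norm x}"
      by (simp add: nx mult.commute)
  qed
  moreover have "closed {x. norm (hs_op A x) \<le> norm A * norm x}"
    by (intro closed_Collect_le continuous_on_norm continuous_on_mult continuous_on_const
        blinfun.continuous_on continuous_on_id)
  ultimately have "closure (span hs_basis) \<subseteq> {x. norm (hs_op A x) \<le> norm A * norm x}"
    by (rule closure_minimal)
  then show "norm (hs_op A x) \<le> norm A * norm x"
    unfolding closure_span_hs_basis by blast
qed (rule norm_ge_zero)

instance hilbert_schmidt ::
  ("{real_inner,banach,second_countable_topology}") banach
proof
  fix X :: "nat \<Rightarrow> 'a hilbert_schmidt"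
  assume X: "Cauchy X"
  have "Cauchy (\<lambda>n. hs_op (X n))"
  proof (rule metric_CauchyI)
    fix e :: real assume "e > 0"
    then obtain M where M: "\<And>m n. m \<ge> M \<Longrightarrow> n \<ge> M \<Longrightarrow> dist (X m) (X n) < e"
      using metric_CauchyD[OF X] by blast
    have "dist (hs_op (X m)) (hs_op (X n)) \<le> dist (X m) (X n)" for m n
      using norm_hs_op_le[of "X m - X n"] by (simp add: dist_norm hs_op_diff)
    with M show "\<exists>M. \<forall>m\<ge>M. \<forall>n\<ge>M. dist (hs_op (X m)) (hs_op (X n)) < e"
      by (meson order_le_less_trans)
  qed
  then obtain A where A: "(\<lambda>n. hs_op (X n)) \<longlonglongrightarrow> A"
    using Cauchy_convergent unfolding convergent_def by blast
  have fin: "(\<Sum>e\<in>F. (norm ((hs_op (X m) - A) e))\<^sup>2) \<le> r\<^sup>2"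
    if F: "finite F" "F \<subseteq> hs_basis" and m: "\<And>n. n \<ge> M \<Longrightarrow> dist (X m) (X n) < r" for F m r M
  proof (rule tendsto_upperbound)
    show "(\<lambda>n. \<Sum>e\<in>F. (norm ((hs_op (X m) - hs_op (X n)) e))\<^sup>2)
        \<longlonglongrightarrow> (\<Sum>e\<in>F. (norm ((hs_op (X m) - A) e))\<^sup>2)"
      by (intro tendsto_sum tendsto_power tendsto_norm blinfun.tendsto tendsto_diff tendsto_const A)
    show "\<forall>\<^sub>F n in sequentially. (\<Sum>e\<in>F. (norm ((hs_op (X m) - hs_op (X n)) e))\<^sup>2) \<le> r\<^sup>2"
    proof (rule eventually_sequentiallyI)
      fix n assume "n \<ge> M"
      have "(\<Sum>e\<in>F. (norm ((hs_op (X m) - hs_op (X n)) e))\<^sup>2) \<le> (norm (X m - X n))\<^sup>2"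
        unfolding hs_norm_power2 hs_op_diff[symmetric]
        using finite_sum_le_infsum[OF hs_summable F] by simp
      also have "\<dots> \<le> r\<^sup>2"
        using m[OF \<open>n \<ge> M\<close>] by (intro power_mono) (simp_all add: dist_norm)
      finally show "(\<Sum>e\<in>F. (norm ((hs_op (X m) - hs_op (X n)) e))\<^sup>2) \<le> r\<^sup>2" .
    qed
  qed simp
  have sm: "(\<lambda>e. (norm ((hs_op (X m) - A) e))\<^sup>2) summable_on hs_basis"
    if "\<And>n. n \<ge> M \<Longrightarrow> dist (X m) (X n) < r" for m r M
    by (rule nonneg_bdd_above_summable_on) (use fin[OF _ _ that] in \<open>auto intro!: bdd_aboveI\<close>)
  obtain M1 where M1: "\<And>m n. m \<ge> M1 \<Longrightarrow> n \<ge> M1 \<Longrightarrow> dist (X m) (X n) < 1"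
    using metric_CauchyD[OF X, of 1] by auto
  have eq: "hs_op (X M1 - Abs_hs (hs_op (X M1) - A)) = A"
    using sm[of M1 M1 1] M1 by (simp add: hs_op_diff Abs_hs_inverse)
  define L where "L = X M1 - Abs_hs (hs_op (X M1) - A)"
  have L: "hs_op L = A" using eq by (simp add: L_def)
  have "X \<longlonglongrightarrow> L"
  proof (rule metric_LIMSEQ_I)
    fix e :: real assume e: "e > 0"
    obtain M where M: "\<And>m n. m \<ge> M \<Longrightarrow> n \<ge> M \<Longrightarrow> dist (X m) (X n) < e / 2"
      using metric_CauchyD[OF X, of "e / 2"] e by auto
    have "dist (X m) L < e" if "m \<ge> M" for m
    proof -
      have "(norm (X m - L))\<^sup>2 \<le> (e / 2)\<^sup>2"
        unfolding hs_norm_power2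
        using fin[of _ M m "e / 2"] M[OF that]
        by (intro infsum_le_finite_sums hs_summable) (simp add: hs_op_diff L)
      then have "norm (X m - L) \<le> e / 2"
        by (rule power2_le_imp_le) (use e in simp)
      then show ?thesis using e by (simp add: dist_norm)
    qed
    then show "\<exists>no. \<forall>n\<ge>no. dist (X n) L < e" by blast
  qed
  then show "convergent X" by (auto simp: convergent_def)
qed


definition normal_op :: "('h::real_inner \<Rightarrow>\<^sub>L 'h) \<Rightarrow> bool" where
  "normal_op C \<longleftrightarrow> C \<circ> adjoint C = adjoint C \<circ> C"

definition compact_op :: "('h::real_normed_vector \<Rightarrow>\<^sub>L 'h) \<Rightarrow> bool" where
  "compact_op C \<longleftrightarrow> compact (closure (C ` cball 0 1))"

definition is_orth_proj :: "('h::real_inner \<Rightarrow>\<^sub>L 'h) \<Rightarrow> 'h set \<Rightarrow> bool" where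
  "is_orth_proj P U \<longleftrightarrow> (\<forall>x. P x \<in> U \<and> (\<forall>u\<in>U. orthogonal (x - P x) u))"


text \<open>
  The time parameter ranges over the nonnegative reals; values at negative times are irrelevant.
\<close>

definition poisson_process :: "'w measure \<Rightarrow> real \<Rightarrow> (real \<Rightarrow> 'w \<Rightarrow> nat) \<Rightarrow> bool" where
  "poisson_process M rate N \<longleftrightarrow>
     prob_space M \<and> rate > 0 \<and>
     (\<forall>t\<ge>0. N t \<in> measurable M (count_space UNIV)) \<and>
     (AE \<omega> in M. N 0 \<omega> = 0) \<and>
     (\<forall>s t. 0 \<le> s \<and> s \<le> t \<longrightarrow> (\<forall>k. measure M {\<omega> \<in> space M. N t \<omega> = N s \<omega> + k} =
        exp (- (rate * (t - s))) * (rate * (t - s)) ^ k / fact k)) \<and>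
     (\<forall>n (\<tau> :: nat \<Rightarrow> real). 0 \<le> \<tau> 0 \<and> mono \<tau> \<longrightarrow>
        prob_space.indep_vars M (\<lambda>_. borel)
          (\<lambda>i \<omega>. real (N (\<tau> (Suc i)) \<omega>) - real (N (\<tau> i) \<omega>)) {..<n}) \<and>
     (AE \<omega> in M. (\<forall>t\<ge>0. continuous (at_right t) (\<lambda>s. N s \<omega>)) \<and>
        (\<forall>t>0. \<exists>l. ((\<lambda>s. N s \<omega>) \<longlongrightarrow> l) (at_left t)))"

text \<open>The jump sizes are \<^term>\<open>X i\<close> for \<^term>\<open>i \<ge> (1::nat)\<close>; \<^term>\<open>X 0\<close> is unused.\<close>

definition compound_poisson ::
  "'w measure \<Rightarrow> real \<Rightarrow> (real \<Rightarrow> 'w \<Rightarrow> nat) \<Rightarrow> (nat \<Rightarrow> 'w \<Rightarrow> 'h::real_normed_vector) \<Rightarrow>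
     (real \<Rightarrow> 'w \<Rightarrow> 'h) \<Rightarrow> bool" where
  "compound_poisson M rate N X L \<longleftrightarrow>
     poisson_process M rate N \<and>
     prob_space.indep_vars M (\<lambda>_. borel) X {1..} \<and>
     (\<forall>i\<ge>1. distr M borel (X i) = distr M borel (X 1)) \<and>
     prob_space.indep_set M
       (sigma_sets (space M) {N t -` A \<inter> space M | t A. 0 \<le> t})
       (sigma_sets (space M) {X i -` A \<inter> space M | i A. 1 \<le> i \<and> A \<in> sets borel}) \<and>
     (\<forall>t\<ge>0. \<forall>\<omega>\<in>space M. L t \<omega> = (\<Sum>i = 1..N t \<omega>. X i \<omega>))"

definition square_integrable_process ::
  "'w measure \<Rightarrow> (real \<Rightarrow> 'w \<Rightarrow> 'h::real_normed_vector) \<Rightarrow> bool" where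
  "square_integrable_process M L \<longleftrightarrow> (\<forall>t\<ge>0. (\<integral>\<^sup>+ \<omega>. ennreal ((norm (L t \<omega>))\<^sup>2) \<partial>M) < \<infinity>)"

text \<open>
  The equation d\<open>V\<close> = \<open>A\<close> \<open>V\<close> d\<open>t\<close> + d\<open>L\<close>, \<open>V\<close>(0) = \<open>V\<^sub>0\<close>, in integrated form.  Since \<open>A\<close> is bounded,
  its solution is unique up to indistinguishability and is the one given by variation of constants.
\<close>

definition solves_linear_sde ::
  "'w measure \<Rightarrow> ('h::real_normed_vector \<Rightarrow>\<^sub>L 'h) \<Rightarrow> ('w \<Rightarrow> 'h) \<Rightarrow> (real \<Rightarrow> 'w \<Rightarrow> 'h) \<Rightarrow>
     (real \<Rightarrow> 'w \<Rightarrow> 'h) \<Rightarrow> bool" where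
  "solves_linear_sde M A V\<^sub>0 L V \<longleftrightarrow>
     (AE \<omega> in M. V 0 \<omega> = V\<^sub>0 \<omega> \<and>
        (\<forall>t\<ge>0. ((\<lambda>s. A (V s \<omega>)) has_integral (V t \<omega> - V\<^sub>0 \<omega> - L t \<omega>)) {0..t}))"


text \<open>The constant takes values in the extended nonnegative reals, as \<open>V\<^sub>0\<close> need not be square-integrable.\<close>

definition approx_const ::
  "'w measure \<Rightarrow> real \<Rightarrow> ('h::real_normed_vector \<Rightarrow>\<^sub>L 'h) \<Rightarrow> ('w \<Rightarrow> 'h) \<Rightarrow> ('w \<Rightarrow> 'h) \<Rightarrow> real \<Rightarrow> ennreal"
  where
  "approx_const M rate C V\<^sub>0 X\<^sub>1 T =
     ennreal (4 * T\<^sup>2 * exp (2 * T * norm C)) *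
       ((\<integral>\<^sup>+ \<omega>. ennreal ((norm (V\<^sub>0 \<omega>))\<^sup>2) \<partial>M)
        + ennreal (rate * T) * (\<integral>\<^sup>+ \<omega>. ennreal ((norm (X\<^sub>1 \<omega>))\<^sup>2) \<partial>M)
        + ennreal (rate\<^sup>2 * T\<^sup>2) * (\<integral>\<^sup>+ \<omega>. ennreal (norm (X\<^sub>1 \<omega>)) \<partial>M)\<^sup>2)"

end

theory Submission
  imports Defs
begin

text \<open>
  Write \<open>\<sigma>\<close> for the supremum of the absolute values of the discarded eigenvalues and \<open>D\<close> for the
  difference of the two solutions.  The same initial value and the same noise drive both equations,
  and the projection commutes with the drift operator because both are diagonal in the basis.  In
  the retained directions the two equations therefore coincide, and uniqueness gives a vanishing
  difference.  In the discarded directions the projected equation has no drift, so \<open>D\<close> is the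
  integral of the projected drift of the full solution, an operator of norm at most \<open>\<sigma>\<close> applied to
  that solution.  Gronwall's inequality bounds the full solution on \<open>[0, T]\<close> by the exponential of
  \<open>T * norm C\<close> times the norm of the initial value plus the sum \<open>S\<close> of the jump sizes up to \<open>T\<close>,
  because \<open>S\<close> dominates the norm of the compound Poisson path.  This pathwise bound,
  \<open>norm (D t) \<le> T * exp (T * norm C) * (norm V\<^sub>0 + S) * \<sigma>\<close>, is the lemma \<open>projected_path_error\<close>.

  Squaring and integrating reduces the estimate to the second moment of \<open>S\<close>.  Conditioning on the
  number of jumps, which is independent of their sizes, expresses it through the mean and the
  second factorial moment of the Poisson law (\<open>nn_integral_total_jump_size_power2\<close>).  Together with
  \<open>(a + b)\<^sup>2 \<le> 2 a\<^sup>2 + 2 b\<^sup>2\<close> this yields the stated constant, with a factor of two to spare.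

  For the convergence, compactness leaves only finitely many eigenvalues above any positive
  threshold; each of them is retained eventually, so the supremum of the discarded squared
  eigenvalues tends to zero (\<open>SUP_eigenvalues_tendsto_0\<close>).  The constant is finite because square
  integrability of the noise forces the jumps to have a finite second moment
  (\<open>square_integrable_jump\<close>).
\<close>

section \<open>Diagonal operators and coordinate projections\<close>

lemma onb_seq_inner:
  assumes "is_onb_seq E"
  shows "E i \<bullet> E j = (if i = j then 1 else 0)"
proof (cases "i = j")
  case True
  then show ?thesis using assms by (auto simp: is_onb_seq_def is_onb_def norm_eq_1)
next
  case False
  then have "E i \<noteq> E j" using assms by (auto simp: is_onb_seq_def inj_eq)
  then show ?thesis
    using assms False by (auto simp: is_onb_seq_def is_onb_def pairwise_def orthogonal_def)
qed

lemma closed_superspace_of_onb_seq: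
  assumes "is_onb_seq E" "closed S" "span (range E) \<subseteq> S"
  shows "x \<in> S"
  using closure_minimal[OF assms(3,2)] assms(1) by (auto simp: is_onb_seq_def is_onb_def)

lemma blinfun_eq_on_onb_seq:
  assumes "is_onb_seq E" "\<And>j. blinfun_apply A (E j) = blinfun_apply B (E j)"
  shows "A = B"
proof (rule blinfun_eqI)
  fix x
  have "x \<in> {x. A x = B x}"
  proof (rule closed_superspace_of_onb_seq[OF assms(1)])
    show "closed {x. A x = B x}" by (intro closed_Collect_eq continuous_intros)
    show "span (range E) \<subseteq> {x. A x = B x}"
      by (rule span_minimal) (auto simp: assms(2) subspace_def blinfun.bilinear_simps)
  qed
  then show "A x = B x" by simp
qed

text \<open>
  On a finite linear combination of basis vectors the bound is Pythagoras' theorem; it passes to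
  all vectors because both sides are continuous and such combinations are dense.
\<close>

lemma norm_diagonal_le:
  assumes E: "is_onb_seq E" and B: "\<And>j. blinfun_apply B (E j) = \<mu> j *\<^sub>R E j"
    and \<mu>: "\<And>j. \<bar>\<mu> j\<bar> \<le> \<sigma>"
  shows "norm B \<le> \<sigma>"
proof (rule norm_blinfun_bound)
  show \<sigma>: "0 \<le> \<sigma>" using \<mu>[of 0] by linarith
  fix x
  have "x \<in> {x. norm (B x) \<le> \<sigma> * norm x}"
  proof (rule closed_superspace_of_onb_seq[OF E])
    show "closed {x. norm (B x) \<le> \<sigma> * norm x}"
      by (intro closed_Collect_le continuous_intros)
    show "span (range E) \<subseteq> {x. norm (B x) \<le> \<sigma> * norm x}"
    proof
      fix x assume "x \<in> span (range E)"
      then obtain G c where G: "finite G" "G \<subseteq> range E" "x = (\<Sum>e\<in>G. c e *\<^sub>R e)"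
        unfolding span_explicit by blast
      have inj: "inj E" using E by (simp add: is_onb_seq_def)
      obtain F where F: "finite F" "G = E ` F"
        using G(1,2) finite_subset_image[of G E UNIV] by auto
      define d where "d j = c (E j)" for j
      have x: "x = (\<Sum>j\<in>F. d j *\<^sub>R E j)"
        using inj by (simp add: G(3) F(2) sum.reindex inj_on_subset d_def)
      have pyth: "(norm (\<Sum>j\<in>F. a j *\<^sub>R E j))\<^sup>2 = (\<Sum>j\<in>F. (a j)\<^sup>2)" for a
        unfolding power2_norm_eq_inner using F(1)
        by (simp add: inner_sum_left inner_sum_right onb_seq_inner[OF E] power2_eq_square
            if_distrib cong: if_cong)
      have "B x = (\<Sum>j\<in>F. (d j * \<mu> j) *\<^sub>R E j)"
        by (simp add: x blinfun.sum_right blinfun.scaleR_right B)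
      then have "(norm (B x))\<^sup>2 = (\<Sum>j\<in>F. (d j * \<mu> j)\<^sup>2)" by (simp add: pyth)
      also have "\<dots> \<le> (\<Sum>j\<in>F. \<sigma>\<^sup>2 * (d j)\<^sup>2)"
      proof (intro sum_mono)
        fix j
        have "(\<mu> j)\<^sup>2 \<le> \<sigma>\<^sup>2" using \<mu>[of j] \<sigma> by (simp add: abs_le_square_iff[symmetric])
        then show "(d j * \<mu> j)\<^sup>2 \<le> \<sigma>\<^sup>2 * (d j)\<^sup>2"
          using mult_right_mono[of "(\<mu> j)\<^sup>2" "\<sigma>\<^sup>2" "(d j)\<^sup>2"]
          by (simp add: power_mult_distrib mult.commute)
      qed
      also have "\<dots> = (\<sigma> * norm x)\<^sup>2"
        by (simp add: x power_mult_distrib pyth sum_distrib_left)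
      finally show "x \<in> {x. norm (B x) \<le> \<sigma> * norm x}"
        using \<sigma> by (auto intro: power2_le_imp_le)
    qed
  qed
  then show "norm (B x) \<le> \<sigma> * norm x" by simp
qed

text \<open>
  The residual \<open>E j - P (E j)\<close> is orthogonal to the subspace.  If \<open>E j\<close> lies in the subspace, the
  residual lies there too and so is orthogonal to itself.  Otherwise \<open>E j\<close> is orthogonal to the
  subspace, hence so is \<open>P (E j)\<close>, which again is orthogonal to itself.
\<close>

lemma orth_proj_onb_seq:
  assumes E: "is_onb_seq E" and P: "is_orth_proj P (span (E ` J))"
  shows "blinfun_apply P (E j) = (if j \<in> J then E j else 0)"
proof -
  have PE: "P (E j) \<in> span (E ` J)"
    and orth: "\<And>u. u \<in> span (E ` J) \<Longrightarrow> (E j - P (E j)) \<bullet> u = 0"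
    using P by (auto simp: is_orth_proj_def orthogonal_def)
  show ?thesis
  proof (cases "j \<in> J")
    case True
    then have "E j - P (E j) \<in> span (E ` J)" by (intro span_diff PE span_base) auto
    from orth[OF this] True show ?thesis by simp
  next
    case False
    have "orthogonal (E j) (P (E j))"
      by (rule orthogonal_to_span[OF PE])
        (use False in \<open>auto simp: orthogonal_def onb_seq_inner[OF E]\<close>)
    then have "P (E j) \<bullet> P (E j) = 0"
      using orth[OF PE] by (simp add: inner_diff_left orthogonal_def)
    then show ?thesis using False by simp
  qed
qed

lemma diagonal_commutes_orth_proj:
  assumes E: "is_onb_seq E" and C: "\<And>j. blinfun_apply C (E j) = \<Lambda> j *\<^sub>R E j"
    and P: "is_orth_proj P (span (E ` J))"
  shows "P (C x) = C (P x)" "P (P x) = P x"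
proof -
  note PE = orth_proj_onb_seq[OF E P]
  have "P o\<^sub>L C = C o\<^sub>L P" "P o\<^sub>L P = P"
    by (rule blinfun_eq_on_onb_seq[OF E]; simp add: PE C blinfun.bilinear_simps)+
  then show "P (C x) = C (P x)" "P (P x) = P x"
    by (metis blinfun_apply_blinfun_compose)+
qed

section \<open>Decay of the eigenvalues of a compact operator\<close>

text \<open>
  Eigenvectors with eigenvalues at least \<open>\<epsilon>\<close> in modulus have images at mutual distance at least \<open>\<epsilon>\<close>,
  and a totally bounded set contains only finitely many such points.
\<close>

lemma compact_op_finite_large_eigenvalues:
  assumes E: "is_onb_seq E" and C: "\<And>j. blinfun_apply C (E j) = \<Lambda> j *\<^sub>R E j"
    and cpt: "compact_op C" and \<epsilon>: "0 < \<epsilon>"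
  shows "finite {j. \<epsilon> \<le> \<bar>\<Lambda> j\<bar>}"
proof (rule ccontr)
  define I where "I = {j. \<epsilon> \<le> \<bar>\<Lambda> j\<bar>}"
  assume "infinite {j. \<epsilon> \<le> \<bar>\<Lambda> j\<bar>}"
  then have I: "infinite I" by (simp add: I_def)
  have sep: "\<epsilon> \<le> dist (C (E i)) (C (E j))" if "i \<in> I" "i \<noteq> j" for i j
  proof (rule power2_le_imp_le)
    have "\<epsilon>\<^sup>2 \<le> (\<Lambda> i)\<^sup>2"
      using that \<epsilon> by (simp add: I_def abs_le_square_iff[symmetric])
    also have "\<dots> \<le> (\<Lambda> i)\<^sup>2 + (\<Lambda> j)\<^sup>2" by simp
    also have "\<dots> = (dist (C (E i)) (C (E j)))\<^sup>2"
      unfolding dist_norm power2_norm_eq_inner using that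
      by (simp add: C inner_diff_left inner_diff_right onb_seq_inner[OF E] power2_eq_square)
    finally show "\<epsilon>\<^sup>2 \<le> (dist (C (E i)) (C (E j)))\<^sup>2" .
  qed simp
  have "seq_compact (closure (C ` cball 0 1))"
    using cpt by (simp add: compact_op_def compact_eq_seq_compact_metric)
  from seq_compact_imp_totally_bounded[OF this] obtain K where
    K: "finite K" "closure (C ` cball 0 1) \<subseteq> (\<Union>x\<in>K. ball x (\<epsilon> / 2))"
    using \<epsilon> by (meson half_gt_zero)
  have "\<exists>x\<in>K. C (E j) \<in> ball x (\<epsilon> / 2)" for j
  proof -
    have "norm (E j) = 1" using E by (auto simp: is_onb_seq_def is_onb_def)
    then have "C (E j) \<in> closure (C ` cball 0 1)" by (intro subsetD[OF closure_subset] imageI) simp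
    then show ?thesis using K(2) by blast
  qed
  then obtain f where f: "\<And>j. f j \<in> K" "\<And>j. C (E j) \<in> ball (f j) (\<epsilon> / 2)" by metis
  \<comment> \<open>Two of the infinitely many points share one of the finitely many balls.\<close>
  have "\<not> inj_on f I"
    using I finite_imageD[of f I] finite_subset[of "f ` I" K] K(1) f(1) by auto
  then obtain i j where ij: "i \<in> I" "j \<in> I" "i \<noteq> j" "f i = f j" by (auto simp: inj_on_def)
  have "dist (C (E i)) (C (E j)) < \<epsilon>"
    using f(2)[of i] f(2)[of j] ij(4) by (auto intro: dist_triangle_half_r)
  then show False using sep[OF ij(1,3)] by simp
qed

text \<open>
  Only finitely many eigenvalues exceed a given positive size, all of them nonzero, so each has its
  index in some \<open>J n\<close>; as the index sets increase, one \<open>n\<close> serves for all of them at once.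
\<close>

lemma SUP_eigenvalues_tendsto_0:
  assumes E: "is_onb_seq E" and C: "\<And>j. blinfun_apply C (E j) = \<Lambda> j *\<^sub>R E j"
    and cpt: "compact_op C" and J: "\<And>n. J n \<subseteq> J (Suc n)" "{j. \<Lambda> j \<noteq> 0} \<subseteq> (\<Union>n. J n)"
  shows "(\<lambda>n. SUP m\<in>- J n. ennreal ((\<Lambda> m)\<^sup>2)) \<longlonglongrightarrow> 0"
proof -
  have "\<forall>\<^sub>F n in sequentially. (SUP m\<in>- J n. ennreal ((\<Lambda> m)\<^sup>2)) < a" if a: "0 < a" for a
  proof -
    obtain a' where a': "0 < a'" "a' < a" using dense[OF a] by blast
    have fin: "a' < \<top>" using a'(2) top_greatest by (rule order_less_le_trans)
    define \<epsilon> where "\<epsilon> = sqrt (enn2real a')"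
    have \<epsilon>: "0 < \<epsilon>" "ennreal (\<epsilon>\<^sup>2) = a'"
      using a' fin by (auto simp: \<epsilon>_def enn2real_positive_iff)
    define I where "I = {j. \<epsilon> \<le> \<bar>\<Lambda> j\<bar>}"
    have I: "finite I" unfolding I_def by (rule compact_op_finite_large_eigenvalues[OF E C cpt \<epsilon>(1)])
    have "\<exists>n. j \<in> J n" if "j \<in> I" for j
      using that J(2) \<epsilon>(1) by (force simp: I_def)
    then obtain k where k: "\<And>j. j \<in> I \<Longrightarrow> j \<in> J (k j)" by metis
    define n0 where "n0 = Max (insert 0 (k ` I))"
    have "(SUP m\<in>- J n. ennreal ((\<Lambda> m)\<^sup>2)) < a" if "n \<ge> n0" for n
    proof (rule order_le_less_trans[OF SUP_least a'(2)])
      fix m assume "m \<in> - J n"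
      moreover have "m \<in> J n" if "m \<in> I"
      proof -
        have "k m \<le> n" using \<open>n \<ge> n0\<close> I that by (simp add: n0_def)
        then show ?thesis using lift_Suc_mono_le[of J, OF J(1)] k[OF that] by blast
      qed
      ultimately have "m \<notin> I" by blast
      then have "\<bar>\<Lambda> m\<bar> \<le> \<epsilon>" by (simp add: I_def)
      then have "(\<Lambda> m)\<^sup>2 \<le> \<epsilon>\<^sup>2" using \<epsilon>(1) by (simp add: abs_le_square_iff[symmetric])
      then show "ennreal ((\<Lambda> m)\<^sup>2) \<le> a'" unfolding \<epsilon>(2)[symmetric] by (rule ennreal_leI)
    qed
    then show ?thesis by (auto simp: eventually_sequentially)
  qed
  then show ?thesis by (intro order_tendstoI) (auto simp: not_less_zero)
qed

section \<open>The pathwise estimate\<close>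

text \<open>
  An indefinite Henstock-Kurzweil integral is continuous, hence bounded on a compact interval.
  This supplies the a priori bound that starts the iteration in Gronwall's inequality below.
\<close>

lemma integral_equation_bounded:
  fixes u r g :: "real \<Rightarrow> 'h::banach"
  assumes u: "\<And>t. t \<in> {0..T} \<Longrightarrow> (g has_integral u t - r t) {0..t}"
    and r: "\<And>t. t \<in> {0..T} \<Longrightarrow> norm (r t) \<le> A"
  obtains B where "\<And>t. t \<in> {0..T} \<Longrightarrow> norm (u t) \<le> B"
proof (cases "0 \<le> T")
  case True
  have "continuous_on {0..T} (\<lambda>t. integral {0..t} g)"
    using u[of T] True by (intro indefinite_integral_continuous_1) (auto simp: has_integral_integrable)
  then have "bounded ((\<lambda>t. integral {0..t} g) ` {0..T})"
    by (intro compact_imp_bounded compact_continuous_image) auto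
  then obtain B where "\<forall>x\<in>(\<lambda>t. integral {0..t} g) ` {0..T}. norm x \<le> B"
    unfolding bounded_iff by (rule exE)
  then have B: "\<And>t. t \<in> {0..T} \<Longrightarrow> norm (integral {0..t} g) \<le> B" by simp
  have "norm (u t) \<le> B + A" if "t \<in> {0..T}" for t
    using B[OF that] r[OF that] norm_triangle_ineq[of "u t - r t" "r t"]
    unfolding integral_unique[OF u[OF that]] by simp
  then show ?thesis by (rule that)
next
  case False
  show ?thesis by (rule that[of 0]) (use False in simp)
qed

text \<open>
  Gronwall's inequality for paths that may jump.  Since only the vector-valued integrand \<open>g\<close> is
  assumed integrable, the integral of the norm of \<open>u\<close> may not exist, so the usual argument through a
  differential inequality for that integral is replaced by an iteration: inserting an estimate of \<open>u\<close> by an explicit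
  smooth function into the equation produces the next such estimate, and the part coming from the
  a priori bound \<open>B\<close> shrinks like a term of the exponential series.
\<close>

lemma gronwall_integral_equation:
  fixes u r g :: "real \<Rightarrow> 'h::banach"
  assumes u: "\<And>t. t \<in> {0..T} \<Longrightarrow> (g has_integral u t - r t) {0..t}"
    and g: "\<And>t. t \<in> {0..T} \<Longrightarrow> norm (g t) \<le> c * norm (u t)"
    and r: "\<And>t. t \<in> {0..T} \<Longrightarrow> norm (r t) \<le> A"
    and c: "0 \<le> c" and t: "t \<in> {0..T}"
  shows "norm (u t) \<le> A * exp (c * t)"
proof -
  obtain B where B: "\<And>t. t \<in> {0..T} \<Longrightarrow> norm (u t) \<le> B"
    using integral_equation_bounded[OF u r] by blast
  have A: "0 \<le> A" using r[OF t] norm_ge_zero order_trans by blast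
  have iter: "norm (u t) \<le> A * exp (c * t) + B * ((c * t) ^ n / fact n)" if "t \<in> {0..T}" for n t
    using that
  proof (induction n arbitrary: t)
    case 0
    then show ?case using B[OF 0] A by (simp add: add_increasing)
  next
    case (Suc n)
    \<comment> \<open>\<open>G'\<close> is \<open>c\<close> times the previous estimate, and \<open>G\<close> is its primitive with \<open>G 0 = A\<close>,
      which is exactly the next estimate.\<close>
    define G where "G s = A * exp (c * s) + B * ((c * s) ^ Suc n / fact (Suc n))" for s
    define G' where "G' s = c * (A * exp (c * s) + B * ((c * s) ^ n / fact n))" for s
    have "(G has_real_derivative G' s) (at s within {0..t})" for s
    proof -
      have "((\<lambda>s. (c * s) ^ Suc n) has_real_derivative real (Suc n) * (c * s) ^ n * c)
          (at s within {0..t})"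
        by (auto intro!: derivative_eq_intros simp del: power_Suc of_nat_Suc)
      from DERIV_cdivide[OF this, of "fact (Suc n)"]
      have "((\<lambda>s. (c * s) ^ Suc n / fact (Suc n)) has_real_derivative (c * s) ^ n * c / fact n)
          (at s within {0..t})"
        by (simp add: fact_Suc del: of_nat_Suc power_Suc)
      note D = DERIV_cmult[OF this, of B]
      have "((\<lambda>s. A * exp (c * s)) has_real_derivative A * (exp (c * s) * c)) (at s within {0..t})"
        by (auto intro!: derivative_eq_intros)
      from DERIV_add[OF this D] show ?thesis
        unfolding G_def G'_def by (simp add: algebra_simps del: fact_Suc power_Suc power_mult_distrib)
    qed
    then have int: "(G' has_integral G t - G 0) {0..t}"
      using Suc.prems by (intro fundamental_theorem_of_calculus)
        (auto simp: has_real_derivative_iff_has_vector_derivative)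
    have "norm (u t - r t) \<le> G t - G 0"
      unfolding integral_unique[OF u[OF Suc.prems], symmetric] integral_unique[OF int, symmetric]
    proof (rule integral_norm_bound_integral)
      show "norm (g s) \<le> G' s" if "s \<in> {0..t}" for s
        using that Suc.prems g[of s] mult_left_mono[OF Suc.IH[of s] c] by (auto simp: G'_def)
    qed (use u[OF Suc.prems] int in \<open>auto simp: has_integral_integrable\<close>)
    then have "norm (u t) \<le> A + (G t - G 0)"
      using r[OF Suc.prems] norm_triangle_ineq[of "u t - r t" "r t"] by simp
    also have "\<dots> = G t" by (simp add: G_def)
    finally show ?case by (simp add: G_def)
  qed
  have "(\<lambda>n. (c * t) ^ n / fact n) \<longlonglongrightarrow> 0"
    using summable_LIMSEQ_zero[OF summable_exp[of "c * t"]] by (simp add: field_simps)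
  then have "(\<lambda>n. A * exp (c * t) + B * ((c * t) ^ n / fact n)) \<longlonglongrightarrow> A * exp (c * t) + B * 0"
    by (intro tendsto_intros)
  then show ?thesis by (intro LIMSEQ_le_const) (use iter[OF t] in auto)
qed

text \<open>
  Let \<open>d = v - w\<close>.  Since \<open>P\<close> commutes with the diagonal operator \<open>C\<close>, the noise \<open>l\<close> cancels and \<open>P d\<close>
  solves the homogeneous equation driven by \<open>C\<close>, so Gronwall's inequality gives \<open>P d = 0\<close>.  The
  projected equation has no drift in the complementary directions, so there \<open>d\<close> is the integral of
  \<open>(1 - P) C v\<close>, where \<open>(1 - P) C\<close> is diagonal with norm at most \<open>\<sigma>\<close>.  A second use of Gronwall's
  inequality bounds \<open>v\<close> itself.  Comparing the two equations directly by Gronwall's inequality would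
  cost a second exponential factor.
\<close>

lemma projected_path_error:
  fixes C P :: "'h::{real_inner,banach} \<Rightarrow>\<^sub>L 'h"
  assumes E: "is_onb_seq E" and C: "\<And>j. blinfun_apply C (E j) = \<Lambda> j *\<^sub>R E j"
    and P: "is_orth_proj P (span (E ` J))"
    and \<sigma>: "0 \<le> \<sigma>" "\<And>j. j \<notin> J \<Longrightarrow> \<bar>\<Lambda> j\<bar> \<le> \<sigma>"
    and v: "\<And>t. t \<in> {0..T} \<Longrightarrow> ((\<lambda>s. C (v s)) has_integral v t - x0 - l t) {0..t}"
    and w: "\<And>t. t \<in> {0..T} \<Longrightarrow> ((\<lambda>s. (P o\<^sub>L C o\<^sub>L P) (w s)) has_integral w t - x0 - l t) {0..t}"
    and l: "\<And>t. t \<in> {0..T} \<Longrightarrow> norm (l t) \<le> S"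
    and t: "t \<in> {0..T}"
  shows "norm (v t - w t) \<le> T * exp (T * norm C) * (norm x0 + S) * \<sigma>"
proof -
  note comm = diagonal_commutes_orth_proj[OF E C P]
  have S: "0 \<le> S" using l[OF t] norm_ge_zero order_trans by blast
  define Q where "Q = id_blinfun - P"
  \<comment> \<open>\<open>Q\<close> kills the directions in \<open>J\<close>, so only the discarded eigenvalues remain in \<open>Q C\<close>.\<close>
  have QE: "(Q o\<^sub>L C) (E j) = (if j \<in> J then 0 else \<Lambda> j) *\<^sub>R E j" for j
    by (simp add: Q_def C orth_proj_onb_seq[OF E P] blinfun.bilinear_simps)
  have QC: "norm (Q o\<^sub>L C) \<le> \<sigma>"
    by (rule norm_diagonal_le[OF E QE]) (use \<sigma> in auto)
  have v_le: "norm (v s) \<le> (norm x0 + S) * exp (T * norm C)" if s: "s \<in> {0..T}" for s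
  proof -
    have "norm (v s) \<le> (norm x0 + S) * exp (norm C * s)"
    proof (rule gronwall_integral_equation[where T=T and r="\<lambda>t. x0 + l t" and g="\<lambda>s. C (v s)"])
      show "norm (x0 + l t) \<le> norm x0 + S" if "t \<in> {0..T}" for t
        using norm_triangle_ineq[of x0 "l t"] l[OF that] by simp
    qed (use v s in \<open>auto simp: diff_diff_eq norm_blinfun\<close>)
    also have "norm C * s \<le> norm C * T" using s by (intro mult_left_mono) auto
    then have "(norm x0 + S) * exp (norm C * s) \<le> (norm x0 + S) * exp (T * norm C)"
      using S by (intro mult_left_mono) (auto simp: mult.commute)
    finally show ?thesis .
  qed
  have diff: "((\<lambda>s. C (v s) - P (C (P (w s)))) has_integral v s - w s) {0..s}"
    if "s \<in> {0..T}" for s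
    using has_integral_diff[OF v[OF that] w[OF that]] by simp
  have "norm (P (v t - w t)) \<le> 0 * exp (norm C * t)"
  proof (rule gronwall_integral_equation[where T=T and r="\<lambda>t. 0" and g="\<lambda>s. C (P (v s - w s))"])
    show "((\<lambda>s. C (P (v s - w s))) has_integral P (v t - w t) - 0) {0..t}" if "t \<in> {0..T}" for t
      using has_integral_linear[OF diff[OF that] blinfun.bounded_linear_right[of P]]
      by (simp add: o_def blinfun.diff_right comm)
  qed (use t in \<open>auto simp: norm_blinfun\<close>)
  then have "Q (v t - w t) = v t - w t" by (simp add: Q_def blinfun.diff_left)
  moreover have "((\<lambda>s. (Q o\<^sub>L C) (v s)) has_integral Q (v t - w t)) {0..t}"
    using has_integral_linear[OF diff[OF t] blinfun.bounded_linear_right[of Q]]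
    by (simp add: o_def Q_def blinfun.diff_right blinfun.diff_left comm)
  ultimately have int: "((\<lambda>s. (Q o\<^sub>L C) (v s)) has_integral v t - w t) {0..t}" by simp
  define K where "K = \<sigma> * ((norm x0 + S) * exp (T * norm C))"
  have K: "0 \<le> K" using \<sigma>(1) S by (simp add: K_def)
  have "norm ((Q o\<^sub>L C) (v s)) \<le> K" if "s \<in> {0..t}" for s
  proof -
    have "norm ((Q o\<^sub>L C) (v s)) \<le> norm (Q o\<^sub>L C) * norm (v s)" by (rule norm_blinfun)
    also have "\<dots> \<le> K"
      unfolding K_def using that t by (intro mult_mono QC v_le \<sigma>(1) norm_ge_zero) simp
    finally show ?thesis .
  qed
  then have "norm (v t - w t) \<le> K * t"
    using has_integral_bound_real[OF K finite.emptyI int] t by simp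
  also have "\<dots> \<le> K * T" using t K by (intro mult_left_mono) auto
  finally show ?thesis by (simp add: K_def mult_ac)
qed

section \<open>The Poisson process\<close>

text \<open>
  Total mass, mean and second factorial moment of the Poisson distribution.  Every index shift
  reduces one sum to the preceding one.
\<close>

lemma poisson_factorial_moments:
  fixes r :: real
  shows "(\<lambda>n. exp (- r) * r ^ n / fact n) sums 1"
    and "(\<lambda>n. exp (- r) * r ^ n / fact n * real n) sums r"
    and "(\<lambda>n. exp (- r) * r ^ n / fact n * real (n * (n - 1))) sums r\<^sup>2"
proof -
  have "(\<lambda>n. r ^ n / fact n) sums exp r"
    using exp_converges[of r] by (simp add: field_simps)
  from sums_mult[OF this, of "exp (- r)"]
  show p: "(\<lambda>n. exp (- r) * r ^ n / fact n) sums 1"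
    by (simp add: exp_minus_inverse mult.commute[of "exp (- r)"] exp_minus)
  have eq: "exp (- r) * r ^ Suc n / fact (Suc n) * real (Suc n) = r * (exp (- r) * r ^ n / fact n)" for n
    by (simp add: fact_Suc field_simps del: of_nat_Suc)
  have "(\<lambda>n. exp (- r) * r ^ Suc n / fact (Suc n) * real (Suc n)) sums r"
    unfolding eq using sums_mult[OF p, of r] by simp
  from sums_Suc[OF this] show q: "(\<lambda>n. exp (- r) * r ^ n / fact n * real n) sums r" by simp
  have eq': "exp (- r) * r ^ Suc n / fact (Suc n) * real (Suc n * (Suc n - 1))
      = r * (exp (- r) * r ^ n / fact n * real n)" for n
  proof -
    have "exp (- r) * r ^ Suc n / fact (Suc n) * real (Suc n * (Suc n - 1))
        = exp (- r) * r ^ Suc n / fact (Suc n) * real (Suc n) * real n"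
      by (simp only: diff_Suc_1 of_nat_mult mult.assoc)
    then show ?thesis unfolding eq by (simp only: mult.assoc)
  qed
  have "(\<lambda>n. exp (- r) * r ^ Suc n / fact (Suc n) * real (Suc n * (Suc n - 1))) sums r\<^sup>2"
    unfolding eq' power2_eq_square by (rule sums_mult[OF q, of r])
  from sums_Suc[OF this] show "(\<lambda>n. exp (- r) * r ^ n / fact n * real (n * (n - 1))) sums r\<^sup>2" by simp
qed

lemma poisson_process_borel_measurable:
  assumes "poisson_process M rate N" "0 \<le> t"
  shows "N t \<in> borel_measurable M"
  by (rule measurable_compose[of _ _ "count_space UNIV" "\<lambda>x. x"])
    (use assms in \<open>simp_all add: poisson_process_def\<close>)

text \<open>
  For fixed times the Poisson law of the increment is carried by the natural numbers, so the
  increment is almost surely nonnegative.  This holds for all rational times simultaneously, and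
  right-continuity of an integer-valued path transfers it to all real times.
\<close>

lemma poisson_process_AE_mono:
  assumes N: "poisson_process M rate N"
  shows "AE \<omega> in M. \<forall>s t. 0 \<le> s \<and> s \<le> t \<longrightarrow> N s \<omega> \<le> N t \<omega>"
proof -
  interpret prob_space M using N by (simp add: poisson_process_def)
  have ordered: "AE \<omega> in M. N s \<omega> \<le> N t \<omega>" if "0 \<le> s" "s \<le> t" for s t
  proof -
    have [measurable]: "N s \<in> borel_measurable M" "N t \<in> borel_measurable M"
      using poisson_process_borel_measurable[OF N] that by auto
    have "(\<lambda>k. \<P>(\<omega> in M. N t \<omega> = N s \<omega> + k)) sums \<P>(\<omega> in M. N s \<omega> \<le> N t \<omega>)"
    proof (intro prob_sums AE_I2)
      fix \<omega>
      have "\<exists>!k. b = a + k" if "a \<le> b" for a b :: nat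
        using that by (auto simp: le_iff_add)
      then show "(\<forall>k. N t \<omega> = N s \<omega> + k \<longrightarrow> N s \<omega> \<le> N t \<omega>)
          \<and> (N s \<omega> \<le> N t \<omega> \<longrightarrow> (\<exists>!k. N t \<omega> = N s \<omega> + k))" by simp
    qed measurable
    moreover have "(\<lambda>k. \<P>(\<omega> in M. N t \<omega> = N s \<omega> + k)) sums 1"
      using N that poisson_factorial_moments(1)[of "rate * (t - s)"] by (simp add: poisson_process_def)
    ultimately have "\<P>(\<omega> in M. N s \<omega> \<le> N t \<omega>) = 1" by (rule sums_unique2)
    from AE_prob_1[OF this] show ?thesis by simp
  qed
  have "AE \<omega> in M. \<forall>p\<in>\<rat>. \<forall>q\<in>\<rat>. 0 \<le> p \<longrightarrow> p \<le> q \<longrightarrow> N p \<omega> \<le> N q \<omega>"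
  proof (intro AE_ball_countable' countable_rat)
    fix p q :: real
    show "AE \<omega> in M. 0 \<le> p \<longrightarrow> p \<le> q \<longrightarrow> N p \<omega> \<le> N q \<omega>"
      using ordered[of p q] by (cases "0 \<le> p \<and> p \<le> q") auto
  qed
  moreover have "AE \<omega> in M. \<forall>t\<ge>0. continuous (at_right t) (\<lambda>s. N s \<omega>)"
    using N by (auto simp: poisson_process_def elim: AE_mp)
  ultimately show ?thesis
  proof eventually_elim
    case (elim \<omega>)
    \<comment> \<open>A right limit of integer values is attained, so the path is constant just after \<open>t\<close>.\<close>
    have near: "\<exists>b>t. \<forall>q. t < q \<and> q < b \<longrightarrow> N q \<omega> = N t \<omega>" if "0 \<le> t" for t
    proof -
      have "((\<lambda>s. N s \<omega>) \<longlongrightarrow> N t \<omega>) (at_right t)"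
        using elim(2) that by (simp add: continuous_within)
      then have "\<forall>\<^sub>F s in at_right t. N s \<omega> = N t \<omega>"
        by (simp add: tendsto_discrete)
      then show ?thesis by (auto simp: eventually_at_right_field)
    qed
    show ?case
    proof (intro allI impI)
      fix s t :: real assume st: "0 \<le> s \<and> s \<le> t"
      show "N s \<omega> \<le> N t \<omega>"
      proof (cases "s = t")
        case False
        obtain b where b: "s < b" "\<And>q. s < q \<Longrightarrow> q < b \<Longrightarrow> N q \<omega> = N s \<omega>"
          using near[of s] st by auto
        obtain b' where b': "t < b'" "\<And>q. t < q \<Longrightarrow> q < b' \<Longrightarrow> N q \<omega> = N t \<omega>"
          using near[of t] st by auto
        obtain p where p: "p \<in> \<rat>" "s < p" "p < min b t"
          using Rats_dense_in_real[of s "min b t"] b(1) False st by auto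
        obtain q where q: "q \<in> \<rat>" "t < q" "q < b'"
          using Rats_dense_in_real[of t b'] b'(1) by auto
        have "N p \<omega> \<le> N q \<omega>" using elim(1) p q st by auto
        then show ?thesis using b(2)[of p] b'(2)[of q] p q by simp
      qed simp
    qed
  qed
qed

lemma poisson_process_distribution:
  assumes N: "poisson_process M rate N" and "0 \<le> t"
  shows "emeasure M {\<omega> \<in> space M. N t \<omega> = n}
    = ennreal (exp (- (rate * t)) * (rate * t) ^ n / fact n)"
proof -
  interpret prob_space M using N by (simp add: poisson_process_def)
  have [measurable]: "N t \<in> borel_measurable M" "N 0 \<in> borel_measurable M"
    using poisson_process_borel_measurable[OF N] \<open>0 \<le> t\<close> by auto
  have "AE \<omega> in M. N 0 \<omega> = 0" using N by (simp add: poisson_process_def)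
  then have "emeasure M {\<omega> \<in> space M. N t \<omega> = n} = emeasure M {\<omega> \<in> space M. N t \<omega> = N 0 \<omega> + n}"
    by (intro emeasure_eq_AE) auto
  also have "\<dots> = ennreal (prob {\<omega> \<in> space M. N t \<omega> = N 0 \<omega> + n})" by (rule emeasure_eq_measure)
  also have "prob {\<omega> \<in> space M. N t \<omega> = N 0 \<omega> + n} = exp (- (rate * t)) * (rate * t) ^ n / fact n"
    using N \<open>0 \<le> t\<close> by (simp add: poisson_process_def)
  finally show ?thesis .
qed

section \<open>Second moment of the total jump size\<close>

text \<open>
  Independence is a statement about events; it extends to integrals by the standard induction over
  functions that are measurable with respect to the generated \<open>\<sigma>\<close>-algebra.
\<close>

lemma (in prob_space) nn_integral_indep_set:
  assumes indep: "indep_set F (sigma_sets (space M) G)" and A: "A \<in> F"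
    and G: "G \<subseteq> Pow (space M)" and Y: "Y \<in> borel_measurable (sigma (space M) G)"
  shows "(\<integral>\<^sup>+\<omega>. indicator A \<omega> * Y \<omega> \<partial>M) = emeasure M A * (\<integral>\<^sup>+\<omega>. Y \<omega> \<partial>M)"
proof -
  have A_ev[measurable]: "A \<in> events" and G_ev: "sigma_sets (space M) G \<subseteq> events"
    using indep A by (auto simp: indep_set_def indep_sets_def UNIV_bool)
  have meas: "Z \<in> borel_measurable M" if "Z \<in> borel_measurable (sigma (space M) G)" for Z :: "'a \<Rightarrow> ennreal"
    by (rule measurable_mono[THEN subsetD, OF _ _ _ _ that]) (use G G_ev in \<open>auto simp: space_measure_of_conv\<close>)
  show ?thesis using Y
  proof (induction rule: borel_measurable_induct)
    case (cong f g)
    then show ?case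
      by (metis (no_types, lifting) nn_integral_cong space_measure_of[OF G])
  next
    case (set B)
    then have B: "B \<in> sigma_sets (space M) G" using G by simp
    then have [measurable]: "B \<in> events" using G_ev by auto
    have "(\<integral>\<^sup>+\<omega>. indicator A \<omega> * indicator B \<omega> \<partial>M) = emeasure M (A \<inter> B)"
      by (simp add: indicator_inter_arith[symmetric])
    also have "\<dots> = emeasure M A * emeasure M B"
      using indep_setD[OF indep A B] by (simp add: emeasure_eq_measure ennreal_mult)
    finally show ?case by simp
  next
    case (mult u c)
    have [measurable]: "u \<in> borel_measurable M" by (rule meas) fact
    show ?case
      using mult by (simp add: nn_integral_cmult mult.left_commute[of _ c])
  next
    case (add u v)
    have [measurable]: "u \<in> borel_measurable M" "v \<in> borel_measurable M" by (rule meas; fact)+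
    show ?case using add by (simp add: nn_integral_add distrib_left)
  next
    case (seq U)
    have [measurable]: "U i \<in> borel_measurable M" for i by (rule meas) (rule seq)
    have "(\<integral>\<^sup>+\<omega>. indicator A \<omega> * (SUP i. U i) \<omega> \<partial>M) = (\<integral>\<^sup>+\<omega>. (SUP i. indicator A \<omega> * U i \<omega>) \<partial>M)"
      by (simp add: SUP_mult_left_ennreal image_comp)
    also have "\<dots> = (SUP i. \<integral>\<^sup>+\<omega>. indicator A \<omega> * U i \<omega> \<partial>M)"
      using seq by (intro nn_integral_monotone_convergence_SUP)
        (auto simp: incseq_def le_fun_def intro!: mult_left_mono)
    also have "\<dots> = emeasure M A * (SUP i. \<integral>\<^sup>+\<omega>. U i \<omega> \<partial>M)"
      by (simp add: seq SUP_mult_left_ennreal)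
    also have "(SUP i. \<integral>\<^sup>+\<omega>. U i \<omega> \<partial>M) = (\<integral>\<^sup>+\<omega>. (SUP i. U i) \<omega> \<partial>M)"
      using seq by (simp add: nn_integral_monotone_convergence_SUP image_comp)
    finally show ?case .
  qed
qed

text \<open>
  Moments of the jumps are taken in the extended nonnegative reals, where sums and integrals may be
  interchanged freely and the case of infinite moments is included.
\<close>

locale compound_poisson_process =
  fixes M :: "'w measure" and rate :: real and N :: "real \<Rightarrow> 'w \<Rightarrow> nat"
    and X :: "nat \<Rightarrow> 'w \<Rightarrow> 'h::real_normed_vector" and L :: "real \<Rightarrow> 'w \<Rightarrow> 'h"
  assumes compound_poisson: "compound_poisson M rate N X L"
begin

lemma poisson: "poisson_process M rate N"
  and X_indep: "prob_space.indep_vars M (\<lambda>_. borel) X {1..}"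
  and X_distr: "i \<ge> 1 \<Longrightarrow> distr M borel (X i) = distr M borel (X 1)"
  and N_X_indep: "prob_space.indep_set M
       (sigma_sets (space M) {N t -` A \<inter> space M | t A. 0 \<le> t})
       (sigma_sets (space M) {X i -` A \<inter> space M | i A. 1 \<le> i \<and> A \<in> sets borel})"
  and L_eq: "0 \<le> t \<Longrightarrow> \<omega> \<in> space M \<Longrightarrow> L t \<omega> = (\<Sum>i = 1..N t \<omega>. X i \<omega>)"
  using compound_poisson unfolding compound_poisson_def by blast+

sublocale prob_space M
  using poisson by (simp add: poisson_process_def)

lemma rate_pos: "0 < rate"
  using poisson by (simp add: poisson_process_def)

lemma N_measurable: "0 \<le> t \<Longrightarrow> N t \<in> measurable M (count_space UNIV)"
  using poisson by (simp add: poisson_process_def)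

lemma X_measurable: "1 \<le> i \<Longrightarrow> X i \<in> borel_measurable M"
  using X_indep by (auto simp: indep_vars_def)

definition jump_size :: "nat \<Rightarrow> 'w \<Rightarrow> ennreal" where
  "jump_size i \<omega> = ennreal (norm (X i \<omega>))"

lemma jump_size_measurable: "1 \<le> i \<Longrightarrow> jump_size i \<in> borel_measurable M"
  unfolding jump_size_def[abs_def] using X_measurable[of i] by measurable

text \<open>
  Distinct jumps are independent, so the expectation factorises; all jumps have the law of the
  first one.
\<close>

lemma nn_integral_jump_size_mult:
  assumes "1 \<le> i" "1 \<le> j"
  shows "(\<integral>\<^sup>+\<omega>. jump_size i \<omega> * jump_size j \<omega> \<partial>M) =
    (if i = j then \<integral>\<^sup>+\<omega>. (jump_size 1 \<omega>)\<^sup>2 \<partial>M else (\<integral>\<^sup>+\<omega>. jump_size 1 \<omega> \<partial>M)\<^sup>2)"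
proof -
  have eq: "(\<integral>\<^sup>+\<omega>. f (X i \<omega>) \<partial>M) = (\<integral>\<^sup>+\<omega>. f (X 1 \<omega>) \<partial>M)"
    if "f \<in> borel_measurable borel" "1 \<le> i" for f and i
    using that X_distr[of i] nn_integral_distr[OF X_measurable[OF that(2)], of f]
      nn_integral_distr[OF X_measurable[of 1], of f] by simp
  show ?thesis
  proof (cases "i = j")
    case True
    have "(\<integral>\<^sup>+\<omega>. (jump_size i \<omega>)\<^sup>2 \<partial>M) = (\<integral>\<^sup>+\<omega>. (jump_size 1 \<omega>)\<^sup>2 \<partial>M)"
      unfolding jump_size_def using \<open>1 \<le> i\<close> by (intro eq) measurable
    with True show ?thesis by (simp add: power2_eq_square)
  next
    case False
    have "indep_vars (\<lambda>_. borel) jump_size {i, j}"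
      unfolding jump_size_def[abs_def]
      by (rule indep_vars_compose2[OF indep_vars_subset[OF X_indep]]) (use assms in auto)
    note prod = indep_vars_nn_integral[OF _ this]
    have mean: "(\<integral>\<^sup>+\<omega>. jump_size k \<omega> \<partial>M) = (\<integral>\<^sup>+\<omega>. jump_size 1 \<omega> \<partial>M)" if "1 \<le> k" for k
      unfolding jump_size_def using that by (intro eq) measurable
    from prod False have "(\<integral>\<^sup>+\<omega>. jump_size i \<omega> * jump_size j \<omega> \<partial>M)
        = (\<integral>\<^sup>+\<omega>. jump_size i \<omega> \<partial>M) * (\<integral>\<^sup>+\<omega>. jump_size j \<omega> \<partial>M)" by simp
    then show ?thesis
      unfolding mean[OF assms(1)] mean[OF assms(2)] using False by (simp add: power2_eq_square)
  qed
qed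

text \<open>
  On the event that exactly \<open>n\<close> jumps have occurred the number of summands is fixed, and the counting
  process is independent of the jump sizes.  Expanding the square leaves \<open>n\<close> diagonal terms and
  \<open>n (n - 1)\<close> products of independent jumps.
\<close>

lemma nn_integral_fixed_count:
  assumes "0 \<le> t"
  shows "(\<integral>\<^sup>+\<omega>. indicator {\<omega> \<in> space M. N t \<omega> = n} \<omega> * (\<Sum>i=1..n. jump_size i \<omega>)\<^sup>2 \<partial>M)
    = emeasure M {\<omega> \<in> space M. N t \<omega> = n} *
      (of_nat n * (\<integral>\<^sup>+\<omega>. (jump_size 1 \<omega>)\<^sup>2 \<partial>M)
        + of_nat (n * (n - 1)) * (\<integral>\<^sup>+\<omega>. jump_size 1 \<omega> \<partial>M)\<^sup>2)"
proof -
  define G where "G = {X i -` A \<inter> space M | i A. 1 \<le> i \<and> A \<in> sets borel}"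
  have G: "G \<subseteq> Pow (space M)" by (auto simp: G_def)
  have "X i \<in> measurable (sigma (space M) G) borel" if "1 \<le> i" for i
    by (rule measurableI) (use that G in \<open>auto simp: G_def intro!: sigma_sets.Basic\<close>)
  then have [measurable]: "jump_size i \<in> borel_measurable (sigma (space M) G)" if "i \<in> {1..n}" for i
    unfolding jump_size_def[abs_def] using that by simp
  have ev: "{\<omega> \<in> space M. N t \<omega> = n} \<in> sigma_sets (space M) {N t -` A \<inter> space M | t A. 0 \<le> t}"
    using assms by (intro sigma_sets.Basic) (auto intro!: exI[of _ t] exI[of _ "{n}"])
  have "(\<integral>\<^sup>+\<omega>. indicator {\<omega> \<in> space M. N t \<omega> = n} \<omega> * (\<Sum>i=1..n. jump_size i \<omega>)\<^sup>2 \<partial>M)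
      = emeasure M {\<omega> \<in> space M. N t \<omega> = n} * (\<integral>\<^sup>+\<omega>. (\<Sum>i=1..n. jump_size i \<omega>)\<^sup>2 \<partial>M)"
    by (rule nn_integral_indep_set[OF N_X_indep[folded G_def] ev G]) measurable
  also have "(\<integral>\<^sup>+\<omega>. (\<Sum>i=1..n. jump_size i \<omega>)\<^sup>2 \<partial>M)
      = (\<integral>\<^sup>+\<omega>. (\<Sum>i=1..n. \<Sum>j=1..n. jump_size i \<omega> * jump_size j \<omega>) \<partial>M)"
    by (simp add: power2_eq_square sum_product)
  also have "\<dots> = (\<Sum>i=1..n. \<Sum>j=1..n. \<integral>\<^sup>+\<omega>. jump_size i \<omega> * jump_size j \<omega> \<partial>M)"
  proof (subst nn_integral_sum)
    show "(\<Sum>i=1..n. \<integral>\<^sup>+\<omega>. (\<Sum>j=1..n. jump_size i \<omega> * jump_size j \<omega>) \<partial>M)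
        = (\<Sum>i=1..n. \<Sum>j=1..n. \<integral>\<^sup>+\<omega>. jump_size i \<omega> * jump_size j \<omega> \<partial>M)"
      by (intro sum.cong refl nn_integral_sum borel_measurable_times_ennreal jump_size_measurable) auto
  qed (intro borel_measurable_sum borel_measurable_times_ennreal jump_size_measurable, auto)
  also have "\<dots> = (\<Sum>i=1..n. \<Sum>j=1..n. if i = j then \<integral>\<^sup>+\<omega>. (jump_size 1 \<omega>)\<^sup>2 \<partial>M
      else (\<integral>\<^sup>+\<omega>. jump_size 1 \<omega> \<partial>M)\<^sup>2)"
    by (intro sum.cong refl nn_integral_jump_size_mult) auto
  also have "\<dots> = (\<Sum>i=1..n. (\<integral>\<^sup>+\<omega>. (jump_size 1 \<omega>)\<^sup>2 \<partial>M)
      + of_nat (n - 1) * (\<integral>\<^sup>+\<omega>. jump_size 1 \<omega> \<partial>M)\<^sup>2)"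
  proof (intro sum.cong refl)
    fix i :: nat and a b :: ennreal assume i: "i \<in> {1..n}"
    have "(\<Sum>j=1..n. if i = j then a else b) = a + (\<Sum>j\<in>{1..n} - {i}. if i = j then a else b)"
      using i by (simp add: sum.remove)
    also have "(\<Sum>j\<in>{1..n} - {i}. if i = j then a else b) = (\<Sum>j\<in>{1..n} - {i}. b)"
      by (intro sum.cong) auto
    finally show "(\<Sum>j=1..n. if i = j then a else b) = a + of_nat (n - 1) * b"
      using i by simp
  qed
  also have "\<dots> = of_nat n * (\<integral>\<^sup>+\<omega>. (jump_size 1 \<omega>)\<^sup>2 \<partial>M)
        + of_nat (n * (n - 1)) * (\<integral>\<^sup>+\<omega>. jump_size 1 \<omega> \<partial>M)\<^sup>2"
    by (simp add: distrib_left mult.assoc)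
  finally show ?thesis .
qed

text \<open>
  Summing over the number of jumps, the mean of the Poisson law multiplies the second moment of a
  jump and its second factorial moment multiplies the squared mean.
\<close>

lemma nn_integral_total_jump_size_power2:
  assumes t: "0 \<le> t"
  shows "(\<integral>\<^sup>+\<omega>. (\<Sum>i=1..N t \<omega>. jump_size i \<omega>)\<^sup>2 \<partial>M)
    = ennreal (rate * t) * (\<integral>\<^sup>+\<omega>. (jump_size 1 \<omega>)\<^sup>2 \<partial>M)
      + ennreal (rate\<^sup>2 * t\<^sup>2) * (\<integral>\<^sup>+\<omega>. jump_size 1 \<omega> \<partial>M)\<^sup>2"
proof -
  define m1 where "m1 = (\<integral>\<^sup>+\<omega>. jump_size 1 \<omega> \<partial>M)\<^sup>2"
  define m2 where "m2 = (\<integral>\<^sup>+\<omega>. (jump_size 1 \<omega>)\<^sup>2 \<partial>M)"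
  define p where "p n = exp (- (rate * t)) * (rate * t) ^ n / fact n" for n
  have p: "0 \<le> p n" for n using t rate_pos by (simp add: p_def)
  note [measurable] = N_measurable[OF t]
  have [measurable]: "(\<lambda>\<omega>. \<Sum>i=1..n. jump_size i \<omega>) \<in> borel_measurable M" for n
    using jump_size_measurable by (intro borel_measurable_sum) auto
  have "(\<Sum>n. indicator {\<omega> \<in> space M. N t \<omega> = n} \<omega> * (\<Sum>i=1..n. jump_size i \<omega>)\<^sup>2)
      = (\<Sum>i=1..N t \<omega>. jump_size i \<omega>)\<^sup>2" if "\<omega> \<in> space M" for \<omega>
    using that by (subst suminf_finite[of "{N t \<omega>}"]) auto
  then have "(\<integral>\<^sup>+\<omega>. (\<Sum>i=1..N t \<omega>. jump_size i \<omega>)\<^sup>2 \<partial>M)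
      = (\<integral>\<^sup>+\<omega>. (\<Sum>n. indicator {\<omega> \<in> space M. N t \<omega> = n} \<omega> * (\<Sum>i=1..n. jump_size i \<omega>)\<^sup>2) \<partial>M)"
    by (simp cong: nn_integral_cong)
  also have "\<dots> = (\<Sum>n. \<integral>\<^sup>+\<omega>. indicator {\<omega> \<in> space M. N t \<omega> = n} \<omega> * (\<Sum>i=1..n. jump_size i \<omega>)\<^sup>2 \<partial>M)"
    by (rule nn_integral_suminf) measurable
  also have "\<dots> = (\<Sum>n. ennreal (p n * real n) * m2 + ennreal (p n * real (n * (n - 1))) * m1)"
    unfolding nn_integral_fixed_count[OF t] poisson_process_distribution[OF poisson t]
    by (simp add: m1_def m2_def p p_def[symmetric] ennreal_mult distrib_left mult.assoc
        flip: ennreal_of_nat_eq_real_of_nat del: of_nat_mult)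
  also have "\<dots> = (\<Sum>n. ennreal (p n * real n)) * m2 + (\<Sum>n. ennreal (p n * real (n * (n - 1)))) * m1"
    by (simp add: suminf_add[symmetric])
  also have "(\<Sum>n. ennreal (p n * real n)) = ennreal (rate * t)"
    by (intro suminf_ennreal_eq mult_nonneg_nonneg p of_nat_0_le_iff)
      (unfold p_def, rule poisson_factorial_moments(2))
  also have "(\<Sum>n. ennreal (p n * real (n * (n - 1)))) = ennreal ((rate * t)\<^sup>2)"
    by (intro suminf_ennreal_eq mult_nonneg_nonneg p of_nat_0_le_iff)
      (unfold p_def, rule poisson_factorial_moments(3))
  finally show ?thesis by (simp add: m1_def m2_def power_mult_distrib)
qed

text \<open>
  With positive probability exactly one jump occurs up to time \<open>1\<close>, and on this event \<open>L 1\<close> is the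
  first jump.  By independence the second moment of the jump is then at most that of \<open>L 1\<close> divided
  by this probability.
\<close>

lemma square_integrable_jump:
  assumes L: "square_integrable_process M L"
  shows "(\<integral>\<^sup>+\<omega>. (jump_size 1 \<omega>)\<^sup>2 \<partial>M) < \<infinity>"
proof -
  define A where "A = {\<omega> \<in> space M. N 1 \<omega> = 1}"
  have "emeasure M A * (\<integral>\<^sup>+\<omega>. (jump_size 1 \<omega>)\<^sup>2 \<partial>M)
      = (\<integral>\<^sup>+\<omega>. indicator A \<omega> * (jump_size 1 \<omega>)\<^sup>2 \<partial>M)"
    using nn_integral_fixed_count[of 1 1] by (simp add: A_def)
  also have "\<dots> \<le> (\<integral>\<^sup>+\<omega>. ennreal ((norm (L 1 \<omega>))\<^sup>2) \<partial>M)"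
    by (intro nn_integral_mono) (auto simp: A_def indicator_def jump_size_def L_eq ennreal_power)
  also have "\<dots> < \<infinity>" using L by (simp add: square_integrable_process_def)
  finally have "emeasure M A * (\<integral>\<^sup>+\<omega>. (jump_size 1 \<omega>)\<^sup>2 \<partial>M) < \<infinity>" .
  moreover have "emeasure M A \<noteq> 0"
    using poisson_process_distribution[OF poisson, of 1 1] rate_pos by (simp add: A_def)
  ultimately show ?thesis by (auto simp: ennreal_mult_less_top)
qed

text \<open>
  The jumps that have occurred by time \<open>t\<close> are among those that have occurred by time \<open>T\<close>.
\<close>

lemma AE_norm_L_le:
  "AE \<omega> in M. \<forall>T\<ge>0. \<forall>t\<in>{0..T}. norm (L t \<omega>) \<le> (\<Sum>i=1..N T \<omega>. norm (X i \<omega>))"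
  using poisson_process_AE_mono[OF poisson] AE_space
proof eventually_elim
  case (elim \<omega>)
  show ?case
  proof (intro allI impI ballI)
    fix T t :: real assume t: "0 \<le> T" "t \<in> {0..T}"
    have "norm (L t \<omega>) \<le> (\<Sum>i=1..N t \<omega>. norm (X i \<omega>))"
      using t elim(2) by (simp add: L_eq norm_sum)
    also have "\<dots> \<le> (\<Sum>i=1..N T \<omega>. norm (X i \<omega>))"
      using t elim(1) by (intro sum_mono2) auto
    finally show "norm (L t \<omega>) \<le> (\<Sum>i=1..N T \<omega>. norm (X i \<omega>))" .
  qed
qed

end

section \<open>The mean-square error bound\<close>

text \<open>
  The pathwise estimate with the total jump size up to \<open>T\<close> as bound for the noise is integrated.
  Where the supremum over times is not measurable, its integral is the supremum of the integrals of
  the simple functions below it, and this is still monotone.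
\<close>

lemma mean_square_projection_error:
  fixes M :: "'w measure" and C P :: "'h::{real_inner,banach} \<Rightarrow>\<^sub>L 'h"
    and V\<^sub>0 :: "'w \<Rightarrow> 'h"
  assumes E: "is_onb_seq E" and C: "\<And>j. blinfun_apply C (E j) = \<Lambda> j *\<^sub>R E j"
    and P: "is_orth_proj P (span (E ` J))"
    and cp: "compound_poisson M rate N X L"
    and V0[measurable]: "V\<^sub>0 \<in> borel_measurable M"
    and V: "solves_linear_sde M C V\<^sub>0 L V"
    and W: "solves_linear_sde M (P o\<^sub>L C o\<^sub>L P) V\<^sub>0 L W"
    and T: "0 < T"
  shows "(\<integral>\<^sup>+ \<omega>. (SUP t\<in>{0..T}. ennreal ((norm (V t \<omega> - W t \<omega>))\<^sup>2)) \<partial>M)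
    \<le> approx_const M rate C V\<^sub>0 (X 1) T * (SUP m\<in>- J. ennreal ((\<Lambda> m)\<^sup>2))"
proof -
  interpret compound_poisson_process M rate N X L by standard fact
  define s where "s = (SUP m\<in>- J. ennreal ((\<Lambda> m)\<^sup>2))"
  have "\<bar>\<Lambda> j\<bar> \<le> norm C" for j
    using norm_blinfun[of C "E j"] onb_seq_inner[OF E, of j j] by (simp add: C norm_eq_sqrt_inner)
  then have "s \<le> ennreal ((norm C)\<^sup>2)"
    unfolding s_def by (intro SUP_least ennreal_leI) (simp add: abs_le_square_iff[symmetric])
  then have s_fin: "s < \<top>" by (rule order_le_less_trans) simp
  define \<sigma> where "\<sigma> = sqrt (enn2real s)"
  have \<sigma>: "0 \<le> \<sigma>" "ennreal (\<sigma>\<^sup>2) = s" using s_fin by (auto simp: \<sigma>_def)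
  have \<sigma>_ge: "\<bar>\<Lambda> j\<bar> \<le> \<sigma>" if "j \<notin> J" for j
  proof -
    have "ennreal ((\<Lambda> j)\<^sup>2) \<le> ennreal (\<sigma>\<^sup>2)"
      unfolding \<sigma>(2) s_def using that by (intro SUP_upper) auto
    then show ?thesis using \<sigma>(1) by (simp add: abs_le_square_iff[symmetric])
  qed
  define S where "S \<omega> = (\<Sum>i=1..N T \<omega>. jump_size i \<omega>)" for \<omega>
  define k where "k = 4 * T\<^sup>2 * exp (2 * T * norm C)"
  have "AE \<omega> in M. (SUP t\<in>{0..T}. ennreal ((norm (V t \<omega> - W t \<omega>))\<^sup>2))
      \<le> (ennreal k * s) * (ennreal ((norm (V\<^sub>0 \<omega>))\<^sup>2) + (S \<omega>)\<^sup>2)"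
    using AE_norm_L_le V[unfolded solves_linear_sde_def] W[unfolded solves_linear_sde_def]
  proof eventually_elim
    case (elim \<omega>)
    define S' where "S' = (\<Sum>i=1..N T \<omega>. norm (X i \<omega>))"
    have S': "0 \<le> S'" "S \<omega> = ennreal S'" by (auto simp: S'_def S_def jump_size_def sum_nonneg)
    show ?case
    proof (rule SUP_least)
      fix t assume t: "t \<in> {0..T}"
      have "norm (V t \<omega> - W t \<omega>) \<le> T * exp (T * norm C) * (norm (V\<^sub>0 \<omega>) + S') * \<sigma>"
        by (rule projected_path_error[where v="\<lambda>t. V t \<omega>" and w="\<lambda>t. W t \<omega>" and l="\<lambda>t. L t \<omega>",
              OF E C P \<sigma>(1) \<sigma>_ge])
          (use elim t T in \<open>auto simp: S'_def\<close>)
      then have "(norm (V t \<omega> - W t \<omega>))\<^sup>2 \<le> (T * exp (T * norm C) * (norm (V\<^sub>0 \<omega>) + S') * \<sigma>)\<^sup>2"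
        by (rule power_mono) simp
      also have "\<dots> = T\<^sup>2 * exp (2 * T * norm C) * \<sigma>\<^sup>2 * (norm (V\<^sub>0 \<omega>) + S')\<^sup>2"
        using exp_double[of "T * norm C"] by (simp add: power_mult_distrib mult.assoc mult.left_commute mult.commute)
      also have "\<dots> \<le> T\<^sup>2 * exp (2 * T * norm C) * \<sigma>\<^sup>2 * (4 * ((norm (V\<^sub>0 \<omega>))\<^sup>2 + S'\<^sup>2))"
      proof (rule mult_left_mono)
        have "(norm (V\<^sub>0 \<omega>) + S')\<^sup>2 \<le> 2 * ((norm (V\<^sub>0 \<omega>))\<^sup>2 + S'\<^sup>2)"
          using sum_squares_bound[of "norm (V\<^sub>0 \<omega>)" S'] by (simp add: power2_sum)
        also have "\<dots> \<le> 4 * ((norm (V\<^sub>0 \<omega>))\<^sup>2 + S'\<^sup>2)" by (intro mult_right_mono) auto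
        finally show "(norm (V\<^sub>0 \<omega>) + S')\<^sup>2 \<le> 4 * ((norm (V\<^sub>0 \<omega>))\<^sup>2 + S'\<^sup>2)" .
      qed simp
      also have "\<dots> = k * \<sigma>\<^sup>2 * ((norm (V\<^sub>0 \<omega>))\<^sup>2 + S'\<^sup>2)" by (simp add: k_def)
      finally have "ennreal ((norm (V t \<omega> - W t \<omega>))\<^sup>2) \<le> ennreal (k * \<sigma>\<^sup>2 * ((norm (V\<^sub>0 \<omega>))\<^sup>2 + S'\<^sup>2))"
        by (rule ennreal_leI)
      also have "\<dots> = (ennreal k * s) * (ennreal ((norm (V\<^sub>0 \<omega>))\<^sup>2) + (S \<omega>)\<^sup>2)"
        by (simp add: \<sigma>(2)[symmetric] S' k_def ennreal_mult ennreal_power)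
      finally show "ennreal ((norm (V t \<omega> - W t \<omega>))\<^sup>2)
          \<le> (ennreal k * s) * (ennreal ((norm (V\<^sub>0 \<omega>))\<^sup>2) + (S \<omega>)\<^sup>2)" .
    qed
  qed
  then have "(\<integral>\<^sup>+ \<omega>. (SUP t\<in>{0..T}. ennreal ((norm (V t \<omega> - W t \<omega>))\<^sup>2)) \<partial>M)
      \<le> (\<integral>\<^sup>+ \<omega>. (ennreal k * s) * (ennreal ((norm (V\<^sub>0 \<omega>))\<^sup>2) + (S \<omega>)\<^sup>2) \<partial>M)"
    by (rule nn_integral_mono_AE)
  also have "\<dots> = (ennreal k * s) * ((\<integral>\<^sup>+ \<omega>. ennreal ((norm (V\<^sub>0 \<omega>))\<^sup>2) \<partial>M) + (\<integral>\<^sup>+ \<omega>. (S \<omega>)\<^sup>2 \<partial>M))"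
  proof -
    have [measurable]: "N T \<in> measurable M (count_space UNIV)" using T by (intro N_measurable) simp
    have "(\<lambda>\<omega>. \<Sum>i=1..n. jump_size i \<omega>) \<in> borel_measurable M" for n
      using jump_size_measurable by (intro borel_measurable_sum) auto
    then have [measurable]: "S \<in> borel_measurable M"
      unfolding S_def[abs_def] by (rule measurable_compose_countable) measurable
    show ?thesis by (simp add: nn_integral_cmult nn_integral_add)
  qed
  also have "\<dots> = approx_const M rate C V\<^sub>0 (X 1) T * s"
    unfolding S_def nn_integral_total_jump_size_power2[OF less_imp_le[OF T]]
    by (simp add: approx_const_def k_def jump_size_def[abs_def] ennreal_power
        mult_ac add_ac)
  finally show ?thesis unfolding s_def .
qed

lemma approx_const_finite:
  assumes cp: "compound_poisson M rate N X L" and L: "square_integrable_process M L"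
    and V0: "(\<integral>\<^sup>+ \<omega>. ennreal ((norm (V\<^sub>0 \<omega>))\<^sup>2) \<partial>M) < \<infinity>"
  shows "approx_const M rate C V\<^sub>0 (X 1) T < \<infinity>"
proof -
  interpret compound_poisson_process M rate N X L by standard fact
  have m2: "(\<integral>\<^sup>+\<omega>. ennreal ((norm (X 1 \<omega>))\<^sup>2) \<partial>M) < \<infinity>"
    using square_integrable_jump[OF L] by (simp add: jump_size_def ennreal_power)
  have "(\<integral>\<^sup>+\<omega>. ennreal (norm (X 1 \<omega>)) \<partial>M) \<le> (\<integral>\<^sup>+\<omega>. 1 + ennreal ((norm (X 1 \<omega>))\<^sup>2) \<partial>M)"
  proof (intro nn_integral_mono)
    fix \<omega>
    have "2 * norm (X 1 \<omega>) \<le> 1 + (norm (X 1 \<omega>))\<^sup>2"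
      using sum_squares_bound[of 1 "norm (X 1 \<omega>)"] by simp
    then have "norm (X 1 \<omega>) \<le> 1 + (norm (X 1 \<omega>))\<^sup>2"
      using norm_ge_zero[of "X 1 \<omega>"] by linarith
    then have "ennreal (norm (X 1 \<omega>)) \<le> ennreal (1 + (norm (X 1 \<omega>))\<^sup>2)" by (rule ennreal_leI)
    then show "ennreal (norm (X 1 \<omega>)) \<le> 1 + ennreal ((norm (X 1 \<omega>))\<^sup>2)" by simp
  qed
  also have "\<dots> = 1 + (\<integral>\<^sup>+\<omega>. ennreal ((norm (X 1 \<omega>))\<^sup>2) \<partial>M)"
    using X_measurable[of 1] by (simp add: nn_integral_add emeasure_space_1)
  also have "\<dots> < \<infinity>" using m2 by (simp add: ennreal_add_less_top)
  finally have "(\<integral>\<^sup>+\<omega>. ennreal (norm (X 1 \<omega>)) \<partial>M) < \<infinity>" .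
  with m2 V0 show ?thesis
    by (simp add: approx_const_def ennreal_mult_less_top ennreal_add_less_top power2_eq_square)
qed

theorem corollary4:
  fixes M :: "'w measure"
    and C :: "'a::{real_inner,banach,second_countable_topology} hilbert_schmidt
                \<Rightarrow>\<^sub>L 'a hilbert_schmidt"
    and E :: "nat \<Rightarrow> 'a hilbert_schmidt"
    and \<Lambda> :: "nat \<Rightarrow> real"
    and J :: "nat \<Rightarrow> nat set"
    and P :: "nat \<Rightarrow> 'a hilbert_schmidt \<Rightarrow>\<^sub>L 'a hilbert_schmidt"
    and rate :: real
    and N :: "real \<Rightarrow> 'w \<Rightarrow> nat"
    and X :: "nat \<Rightarrow> 'w \<Rightarrow> 'a hilbert_schmidt"
    and L :: "real \<Rightarrow> 'w \<Rightarrow> 'a hilbert_schmidt"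
    and V\<^sub>0 :: "'w \<Rightarrow> 'a hilbert_schmidt"
    and V :: "real \<Rightarrow> 'w \<Rightarrow> 'a hilbert_schmidt"
    and Vn :: "nat \<Rightarrow> real \<Rightarrow> 'w \<Rightarrow> 'a hilbert_schmidt"
  assumes "prob_space M"
    and "normal_op C" and "compact_op C"
    and "is_onb_seq E" and "\<And>j. C (E j) = \<Lambda> j *\<^sub>R E j"
    and "\<And>n. finite (J n)" and "\<And>n. J n \<subseteq> J (Suc n)"
    and "\<And>n. is_orth_proj (P n) (span (E ` J n))"
    and "compound_poisson M rate N X L" and "square_integrable_process M L"
    and "V\<^sub>0 \<in> borel_measurable M"
    and "solves_linear_sde M C V\<^sub>0 L V"
    and "\<And>n. solves_linear_sde M (P n o\<^sub>L C o\<^sub>L P n) V\<^sub>0 L (Vn n)"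
  shows "(\<forall>T>0. \<forall>n.
            (\<integral>\<^sup>+ \<omega>. (SUP t\<in>{0..T}. ennreal ((norm (V t \<omega> - Vn n t \<omega>))\<^sup>2)) \<partial>M)
              \<le> approx_const M rate C V\<^sub>0 (X 1) T * (SUP m\<in>- J n. ennreal ((\<Lambda> m)\<^sup>2)))
       \<and> ((\<integral>\<^sup>+ \<omega>. ennreal ((norm (V\<^sub>0 \<omega>))\<^sup>2) \<partial>M) < \<infinity> \<longrightarrow> {j. \<Lambda> j \<noteq> 0} \<subseteq> (\<Union>n. J n) \<longrightarrow>
          (\<forall>T>0. (\<lambda>n. approx_const M rate C V\<^sub>0 (X 1) T * (SUP m\<in>- J n. ennreal ((\<Lambda> m)\<^sup>2)))
                   \<longlonglongrightarrow> 0))"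
proof (intro conjI allI impI)
  fix T :: real and n assume "T > 0"
  then show "(\<integral>\<^sup>+ \<omega>. (SUP t\<in>{0..T}. ennreal ((norm (V t \<omega> - Vn n t \<omega>))\<^sup>2)) \<partial>M)
      \<le> approx_const M rate C V\<^sub>0 (X 1) T * (SUP m\<in>- J n. ennreal ((\<Lambda> m)\<^sup>2))"
    by (rule mean_square_projection_error[OF assms(4,5,8,9,11,12,13)])
next
  fix T :: real
  assume V0: "(\<integral>\<^sup>+ \<omega>. ennreal ((norm (V\<^sub>0 \<omega>))\<^sup>2) \<partial>M) < \<infinity>" and J: "{j. \<Lambda> j \<noteq> 0} \<subseteq> (\<Union>n. J n)"
  have "approx_const M rate C V\<^sub>0 (X 1) T < \<infinity>" by (rule approx_const_finite[OF assms(9,10) V0])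
  moreover have "(\<lambda>n. SUP m\<in>- J n. ennreal ((\<Lambda> m)\<^sup>2)) \<longlonglongrightarrow> 0"
    by (rule SUP_eigenvalues_tendsto_0[OF assms(4,5,3,7) J])
  ultimately show "(\<lambda>n. approx_const M rate C V\<^sub>0 (X 1) T * (SUP m\<in>- J n. ennreal ((\<Lambda> m)\<^sup>2)))
      \<longlonglongrightarrow> 0"
    using ennreal_tendsto_cmult[of "approx_const M rate C V\<^sub>0 (X 1) T"] by fastforce
qed

end
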